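(* Let $K$ be a perfect field, let $P=K[x_1,\dots,x_n]$, and let $I$ be an ideal in $P$. Consider the following procedure. 1. If $I$ is not zero-dimensional, return false. 2. Compute $d=\dim_K(P/I)$. 3. First Loop: for $i=1,\dots,n$ do: 3.1. compute $\mu=\mu_{x_i,I}$; 3.2. if $\mu$ is reducible then return false; 3.3. if $\deg(\mu)=d$ then return true. 4. If $K$ is finite, with $q=\#K$: compute $s=\dim_K(\mathrm{Frob}_q(P/I))$; if $s=1$ return true, else return false. 5. (Otherwise $K$ is infinite.) Second Loop: repeat: 5.1. pick a random linear form $\ell\in P$ and compute $\mu=\mu_{\ell,I}$; 5.2. if $\mu$ is reducible then return false; 5.3. if $\deg(\mu)=d$ then return true. Then, whatever linear forms are picked in the Second Loop, whenever the procedure returns an answer this answer is true if $I$ is a maximal ideal and false if $I$ is not a maximal ideal. If $K$ is finite, the procedure always terminates.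
   Context: An ideal $I$ of $P$ is zero-dimensional if $P/I$ is non-zero and finite-dimensional over $K$. For $f\in P$ and zero-dimensional $I$, the minimal polynomial $\mu_{f,I}(z)\in K[z]$ is the monic generator of the kernel of the $K$-algebra homomorphism $K[z]\to P/I$, $z\mapsto f\bmod I$. If $K$ is a finite field with $q$ elements and $R=P/I$ is a zero-dimensional $K$-algebra, the map $\Phi_q:R\to R$, $a\mapsto a^q$, is a $K$-linear endomorphism, and the $q$-Frobenius space of $R$ is its fixed-point space $\mathrm{Frob}_q(R)=\{a\in R: a^q-a=0\}$, a $K$-vector subspace of $R$. The basic operations in the procedure are assumed to be computable. *)

theory Defs
  imports
    "HOL-Library.Poly_Mapping"
    "HOL-Algebra.Algebraic_Closure_Type"
    "HOL-Algebra.Embedded_Algebras"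
    "HOL-Computational_Algebra.Computational_Algebra"
begin

definition perfect_field :: "'k::field itself \<Rightarrow> bool" where
  "perfect_field _ \<longleftrightarrow> CHAR('k) = 0 \<or> (\<forall>a::'k. \<exists>b. b ^ CHAR('k) = a)"

text \<open>
  A polynomial is a finitely supported map from exponent vectors to coefficients, with
  convolution as product. The type offers the indeterminates \<open>x\<^sub>i\<close> for all natural
  numbers \<open>i\<close>; the ring in \<open>x\<^sub>1, \<dots>, x\<^sub>n\<close> is cut out by the carrier.
\<close>

type_synonym 'k mpoly = "(nat \<Rightarrow>\<^sub>0 nat) \<Rightarrow>\<^sub>0 'k"

definition mpoly_ring :: "nat \<Rightarrow> 'k::field mpoly ring" where
  "mpoly_ring n =
     ring_of_type_algebra
       \<lparr>carrier := {p. \<forall>m \<in> Poly_Mapping.keys p. Poly_Mapping.keys m \<subseteq> {1..n}}\<rparr>"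

definition Const :: "'k::field \<Rightarrow> 'k mpoly" where
  "Const c = Poly_Mapping.single 0 c"

definition Var :: "nat \<Rightarrow> 'k::field mpoly" where
  "Var i = Poly_Mapping.single (Poly_Mapping.single i 1) 1"

text \<open>The zero form is included.\<close>

definition linear_forms :: "nat \<Rightarrow> 'k::field mpoly set" where
  "linear_forms n = {(\<Sum>i\<in>{1..n}. Const (c i) * Var i) | c. True}"

abbreviation residue_alg :: "nat \<Rightarrow> 'k::field mpoly set \<Rightarrow> 'k mpoly set ring" where
  "residue_alg n I \<equiv> mpoly_ring n Quot I"

text \<open>
  The dimension theory of \<open>Embedded_Algebras\<close> takes scalars from a subfield of the
  ambient ring. The scalars used here are the residue classes of the constants; for a
  proper ideal \<open>I\<close> they form a copy of \<open>K\<close> in \<open>P/I\<close>, through which \<open>K\<close> acts.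
\<close>

definition scalars :: "nat \<Rightarrow> 'k::field mpoly set \<Rightarrow> 'k mpoly set set" where
  "scalars n I = range (\<lambda>c. I +>\<^bsub>mpoly_ring n\<^esub> Const c)"

definition dimK :: "nat \<Rightarrow> 'k::field mpoly set \<Rightarrow> 'k mpoly set set \<Rightarrow> nat" where
  "dimK n I V = ring.dim (residue_alg n I) (scalars n I) V"

definition zero_dimensional :: "nat \<Rightarrow> 'k::field mpoly set \<Rightarrow> bool" where
  "zero_dimensional n I \<longleftrightarrow>
     carrier (residue_alg n I) \<noteq> {\<zero>\<^bsub>residue_alg n I\<^esub>} \<and>
     ring.finite_dimension (residue_alg n I) (scalars n I) (carrier (residue_alg n I))"

definition residue_eval :: "nat \<Rightarrow> 'k::field mpoly set \<Rightarrow> 'k mpoly \<Rightarrow> 'k poly \<Rightarrow> 'k mpoly set" where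
  "residue_eval n I f g = I +>\<^bsub>mpoly_ring n\<^esub> poly (map_poly Const g) f"

definition min_poly :: "nat \<Rightarrow> 'k::field mpoly set \<Rightarrow> 'k mpoly \<Rightarrow> 'k poly" where
  "min_poly n I f =
     (THE \<mu>. lead_coeff \<mu> = 1 \<and>
        PIdl\<^bsub>ring_of_type_algebra\<^esub> \<mu> =
          a_kernel ring_of_type_algebra (residue_alg n I) (residue_eval n I f))"

definition frob_space :: "nat \<Rightarrow> ('a, 'b) ring_scheme \<Rightarrow> 'a set" where
  "frob_space q R = {a \<in> carrier R. a [^]\<^bsub>R\<^esub> q \<ominus>\<^bsub>R\<^esub> a = \<zero>\<^bsub>R\<^esub>}"

definition reducible :: "'k::field poly \<Rightarrow> bool" where
  "reducible p \<longleftrightarrow> p \<noteq> 0 \<and> \<not> p dvd 1 \<and> \<not> Factorial_Ring.irreducible p"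

text \<open>
  A small-step transition system. A state names the instruction to be executed next and
  carries the current values of the program variables \<open>d\<close>, \<open>i\<close>, \<open>\<mu>\<close>. The random
  choice in the second loop is nondeterministic: every linear form gives a transition.
\<close>

datatype 'p state =
    Step1
  | Step2
  | Step3_1 nat nat
  | Step3_2 nat nat 'p
  | Step3_3 nat nat 'p
  | Step4 nat
  | Step5_1 nat
  | Step5_2 nat 'p
  | Step5_3 nat 'p
  | Return bool

inductive proc_step :: "nat \<Rightarrow> 'k::field mpoly set \<Rightarrow> 'k poly state \<Rightarrow> 'k poly state \<Rightarrow> bool"
  for n :: nat and I :: "'k::field mpoly set" where
  s1_no: "\<not> zero_dimensional n I \<Longrightarrow> proc_step n I Step1 (Return False)"
| s1_yes: "zero_dimensional n I \<Longrightarrow> proc_step n I Step1 Step2"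
| s2: "proc_step n I Step2 (Step3_1 (dimK n I (carrier (residue_alg n I))) 1)"
| s31: "i \<le> n \<Longrightarrow> proc_step n I (Step3_1 d i) (Step3_2 d i (min_poly n I (Var i)))"
| s31_end: "i > n \<Longrightarrow> proc_step n I (Step3_1 d i) (Step4 d)"
| s32_red: "reducible \<mu> \<Longrightarrow> proc_step n I (Step3_2 d i \<mu>) (Return False)"
| s32: "\<not> reducible \<mu> \<Longrightarrow> proc_step n I (Step3_2 d i \<mu>) (Step3_3 d i \<mu>)"
| s33_eq: "Polynomial.degree \<mu> = d \<Longrightarrow> proc_step n I (Step3_3 d i \<mu>) (Return True)"
| s33: "Polynomial.degree \<mu> \<noteq> d \<Longrightarrow> proc_step n I (Step3_3 d i \<mu>) (Step3_1 d (Suc i))"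
| s4_fin: "finite (UNIV :: 'k set) \<Longrightarrow>
    proc_step n I (Step4 d)
      (Return (dimK n I (frob_space (card (UNIV :: 'k set)) (residue_alg n I)) = 1))"
| s4_inf: "infinite (UNIV :: 'k set) \<Longrightarrow> proc_step n I (Step4 d) (Step5_1 d)"
| s51: "l \<in> linear_forms n \<Longrightarrow> proc_step n I (Step5_1 d) (Step5_2 d (min_poly n I l))"
| s52_red: "reducible \<mu> \<Longrightarrow> proc_step n I (Step5_2 d \<mu>) (Return False)"
| s52: "\<not> reducible \<mu> \<Longrightarrow> proc_step n I (Step5_2 d \<mu>) (Step5_3 d \<mu>)"
| s53_eq: "Polynomial.degree \<mu> = d \<Longrightarrow> proc_step n I (Step5_3 d \<mu>) (Return True)"
| s53: "Polynomial.degree \<mu> \<noteq> d \<Longrightarrow> proc_step n I (Step5_3 d \<mu>) (Step5_1 d)"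

definition returns :: "nat \<Rightarrow> 'k::field mpoly set \<Rightarrow> bool \<Rightarrow> bool" where
  "returns n I b \<longleftrightarrow> (proc_step n I)\<^sup>*\<^sup>* Step1 (Return b)"

text \<open>There is no infinite run, and a run can stop only by returning an answer.\<close>

definition always_terminates :: "nat \<Rightarrow> 'k::field mpoly set \<Rightarrow> bool" where
  "always_terminates n I \<longleftrightarrow>
     \<not> (\<exists>\<sigma>. \<sigma> 0 = Step1 \<and> (\<forall>t. proc_step n I (\<sigma> t) (\<sigma> (Suc t)))) \<and>
     (\<forall>s. (proc_step n I)\<^sup>*\<^sup>* Step1 s \<longrightarrow> (\<exists>b. s = Return b) \<or> (\<exists>s'. proc_step n I s s'))"

end

theory Submission
  imports Defs
begin

text \<open>
  Write \<open>P\<close> for the polynomial ring in \<open>n\<close> indeterminates over \<open>K\<close>, and \<open>d\<close> for the dimension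
  of \<open>P/I\<close>. Correctness of the answers rests on the following facts.

  The answer false in the first step is right because a maximal ideal is zero-dimensional
  (\<open>maximal_imp_zero_dimensional\<close>). This is Zariski's lemma: a field that is generated as a ring
  by \<open>K\<close> and finitely many elements has finite dimension over \<open>K\<close>. The argument avoids integral
  extensions and fraction fields. Call a subring \<open>S\<close> of the field a G-domain if inverting a
  single non-zero element of \<open>S\<close> turns it into a field. If \<open>S[u]\<close> is a G-domain then \<open>u\<close> is
  algebraic over \<open>S\<close> (\<open>G_domain_adjoin_imp_algebraic\<close>) and \<open>S\<close> itself is a G-domain
  (\<open>G_domain_descends\<close>). Removing the generators one after the other, in an order where
  \<open>x\<^sub>i\<close> comes last, shows that \<open>x\<^sub>i\<close> is algebraic over \<open>K\<close>. All of this is carried out with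
  congruences modulo a prime ideal instead of elements of a quotient.

  The answers that depend on a minimal polynomial \<open>\<mu>\<close> of an element \<open>f\<close> are right because \<open>K[z]/\<mu>\<close>
  is the subalgebra of \<open>P/I\<close> generated by \<open>f\<close>. If \<open>I\<close> is maximal this subalgebra is a domain, so
  \<open>\<mu>\<close> is irreducible (\<open>maximal_imp_not_reducible\<close>). If \<open>\<mu>\<close> is irreducible of degree \<open>d\<close>, the
  subalgebra is a field and equals \<open>P/I\<close> for reasons of dimension (\<open>full_degree_imp_maximal\<close>).

  Let \<open>K\<close> have \<open>q\<close> elements, and suppose that the minimal polynomials of all indeterminates are
  irreducible. Then each \<open>x\<^sub>i\<close> lies in a finite subfield of \<open>P/I\<close> and is therefore a \<open>q\<close>-th power
  there, so the \<open>q\<close>-Frobenius map of the finite ring \<open>P/I\<close> is surjective, hence injective, and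
  \<open>P/I\<close> is reduced. In a finite reduced ring every non-zero \<open>a\<close> has a power \<open>a\<^sup>p\<close>, \<open>p > 0\<close>, that is
  a non-zero idempotent. Idempotents lie in the Frobenius space; if that space is just \<open>K\<close>, then
  \<open>a\<^sup>p\<close> is a non-zero constant and \<open>a\<close> is invertible (\<open>frob_dim_1_imp_maximal\<close>). Conversely, in a
  field the equation \<open>a\<^sup>q = a\<close> has only the \<open>q\<close> solutions in \<open>K\<close>, because \<open>X\<^sup>q - X\<close> is the product
  of the linear factors \<open>X - c\<close> (\<open>maximal_imp_frob_dim_1\<close>).

  These facts make \<open>run_invariant\<close> an invariant of the transition system; termination over a
  finite field follows since the second loop is never entered and the first loop is bounded.
\<close>

section \<open>Subrings and polynomials with coefficients in them\<close>

locale unital_subring =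
  fixes S :: "'a::comm_ring_1 set"
  assumes one_mem: "1 \<in> S"
    and diff_mem: "x \<in> S \<Longrightarrow> y \<in> S \<Longrightarrow> x - y \<in> S"
    and mult_mem: "x \<in> S \<Longrightarrow> y \<in> S \<Longrightarrow> x * y \<in> S"
begin

lemma zero_mem: "0 \<in> S"
  using diff_mem[OF one_mem one_mem] by simp

lemma uminus_mem: "x \<in> S \<Longrightarrow> - x \<in> S"
  using diff_mem[OF zero_mem, of x] by simp

lemma add_mem: "x \<in> S \<Longrightarrow> y \<in> S \<Longrightarrow> x + y \<in> S"
  using diff_mem[OF _ uminus_mem[of y], of x] by simp

lemma power_mem: "x \<in> S \<Longrightarrow> x ^ k \<in> S"
  by (induction k) (auto intro: one_mem mult_mem)

lemma sum_mem: "(\<And>i. i \<in> T \<Longrightarrow> f i \<in> S) \<Longrightarrow> sum f T \<in> S"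
  by (induction T rule: infinite_finite_induct) (auto intro: zero_mem add_mem)

lemmas closed = zero_mem one_mem add_mem diff_mem uminus_mem mult_mem power_mem

end

definition polys_over :: "'a::comm_ring_1 set \<Rightarrow> 'a poly set" where
  "polys_over S = {p. \<forall>i. Polynomial.coeff p i \<in> S}"

definition adjoin :: "'a::comm_ring_1 set \<Rightarrow> 'a \<Rightarrow> 'a set" where
  "adjoin S u = (\<lambda>p. poly p u) ` polys_over S"

lemma polys_over_mono: "S \<subseteq> T \<Longrightarrow> polys_over S \<subseteq> polys_over T"
  by (auto simp: polys_over_def)

lemma polys_over_coeff: "p \<in> polys_over S \<Longrightarrow> Polynomial.coeff p i \<in> S"
  by (simp add: polys_over_def)

context unital_subring
begin

lemma polys_over_pCons: "c \<in> S \<Longrightarrow> p \<in> polys_over S \<Longrightarrow> pCons c p \<in> polys_over S"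
  by (auto simp: polys_over_def coeff_pCons split: nat.split)

lemma polys_over_0: "0 \<in> polys_over S"
  by (simp add: polys_over_def zero_mem)

lemma polys_over_const: "c \<in> S \<Longrightarrow> [:c:] \<in> polys_over S"
  by (intro polys_over_pCons polys_over_0)

lemma polys_over_monom: "c \<in> S \<Longrightarrow> Polynomial.monom c k \<in> polys_over S"
  by (simp add: polys_over_def zero_mem)

lemma polys_over_smult: "c \<in> S \<Longrightarrow> p \<in> polys_over S \<Longrightarrow> Polynomial.smult c p \<in> polys_over S"
  by (simp add: polys_over_def mult_mem)

lemma polys_over_subring: "unital_subring (polys_over S)"
  by unfold_locales
    (auto simp: polys_over_def Polynomial.coeff_1 coeff_mult intro!: closed sum_mem)

lemmas polys_closed = unital_subring.closed[OF polys_over_subring]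

lemma adjoin_subring: "unital_subring (adjoin S u)"
proof
  show "1 \<in> adjoin S u"
    unfolding adjoin_def by (rule image_eqI[OF _ unital_subring.one_mem[OF polys_over_subring]]) simp
next
  fix x y assume "x \<in> adjoin S u" "y \<in> adjoin S u"
  then obtain p q where "p \<in> polys_over S" "q \<in> polys_over S" "x = poly p u" "y = poly q u"
    by (auto simp: adjoin_def)
  then have "x - y = poly (p - q) u" "x * y = poly (p * q) u"
    and "p - q \<in> polys_over S" "p * q \<in> polys_over S"
    by (auto intro: polys_closed)
  then show "x - y \<in> adjoin S u" "x * y \<in> adjoin S u"
    unfolding adjoin_def by (blast intro: image_eqI)+
qed

lemma subset_adjoin: "S \<subseteq> adjoin S u"
proof
  fix x assume "x \<in> S"
  then show "x \<in> adjoin S u"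
    unfolding adjoin_def by (intro image_eqI[OF _ polys_over_const]) auto
qed

lemma generator_in_adjoin: "u \<in> adjoin S u"
  unfolding adjoin_def
  by (rule image_eqI[OF _ polys_over_pCons[OF zero_mem polys_over_const[OF one_mem]]]) simp

lemma poly_mem: "p \<in> polys_over S \<Longrightarrow> u \<in> S \<Longrightarrow> poly p u \<in> S"
proof (induction p)
  case 0
  then show ?case by (simp add: zero_mem)
next
  case (pCons c p)
  have "c \<in> S" "p \<in> polys_over S"
    using polys_over_coeff[OF pCons.prems(1), of 0] pCons.prems(1)
    by (auto simp: polys_over_def coeff_pCons split: nat.splits)
  then show ?case
    using pCons by (auto intro: closed)
qed

lemma adjoin_subset: "S \<subseteq> T \<Longrightarrow> unital_subring T \<Longrightarrow> u \<in> T \<Longrightarrow> adjoin S u \<subseteq> T"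
  using unital_subring.poly_mem[of T _ u] polys_over_mono[of S T] by (auto simp: adjoin_def)

text \<open>
  The leading coefficient of \<open>g\<close> need not be invertible in \<open>S\<close>; multiplying \<open>f\<close> by a power of it
  beforehand makes division with remainder possible. The degree bound on the quotient is what the
  minimality arguments below rely on.
\<close>

lemma pseudo_division:
  assumes f: "f \<in> polys_over S" and g: "g \<in> polys_over S" "g \<noteq> 0"
  obtains k q r where "q \<in> polys_over S" "r \<in> polys_over S"
    "Polynomial.smult (Polynomial.lead_coeff g ^ k) f = q * g + r"
    "r = 0 \<or> Polynomial.degree r < Polynomial.degree g"
    "Polynomial.degree q \<le> Polynomial.degree f - Polynomial.degree g"
proof -
  define b where "b = Polynomial.lead_coeff g"
  have "\<exists>k q r. q \<in> polys_over S \<and> r \<in> polys_over S \<and> Polynomial.smult (b ^ k) f = q * g + r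
     \<and> (r = 0 \<or> Polynomial.degree r < Polynomial.degree g)
     \<and> Polynomial.degree q \<le> Polynomial.degree f - Polynomial.degree g"
    using f
  proof (induction "if f = 0 then 0 else Suc (Polynomial.degree f)" arbitrary: f rule: less_induct)
    case less
    show ?case
    proof (cases "f = 0 \<or> Polynomial.degree f < Polynomial.degree g")
      case True
      then show ?thesis
        using less.prems polys_over_0
        by (intro exI[of _ 0] exI[of _ f]) auto
    next
      case False
      then have f0: "f \<noteq> 0" and le: "Polynomial.degree g \<le> Polynomial.degree f" by auto
      define a where "a = Polynomial.lead_coeff f"
      define m where "m = Polynomial.monom a (Polynomial.degree f - Polynomial.degree g)"
      define f1 where "f1 = Polynomial.smult b f - m * g"
      have mem: "a \<in> S" "b \<in> S" "m \<in> polys_over S"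
        using less.prems g by (auto simp: a_def b_def m_def polys_over_coeff intro!: polys_over_monom)
      then have f1: "f1 \<in> polys_over S"
        unfolding f1_def using less.prems g by (intro polys_closed polys_over_smult) auto
      have deg_m: "Polynomial.degree m \<le> Polynomial.degree f - Polynomial.degree g"
        by (simp add: m_def degree_monom_le)
      have deg_mg: "Polynomial.degree (m * g) \<le> Polynomial.degree f"
        using degree_mult_le[of m g] deg_m le by linarith
      have deg: "Polynomial.degree f1 \<le> Polynomial.degree f"
        unfolding f1_def by (intro degree_diff_le degree_smult_le deg_mg)
      have "Polynomial.coeff (m * g) (Polynomial.degree f) = a * b"
        using le by (simp add: m_def b_def coeff_monom_mult)
      then have top: "Polynomial.coeff f1 (Polynomial.degree f) = 0"
        by (simp add: f1_def a_def mult.commute)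
      have smaller: "f1 = 0 \<or> Polynomial.degree f1 < Polynomial.degree f"
        using deg top by (metis leading_coeff_0_iff le_neq_implies_less)
      then have "(if f1 = 0 then 0 else Suc (Polynomial.degree f1))
          < (if f = 0 then 0 else Suc (Polynomial.degree f))"
        using f0 by auto
      from less.hyps[OF this f1] obtain k q r where IH: "q \<in> polys_over S" "r \<in> polys_over S"
        "Polynomial.smult (b ^ k) f1 = q * g + r"
        "r = 0 \<or> Polynomial.degree r < Polynomial.degree g"
        "Polynomial.degree q \<le> Polynomial.degree f1 - Polynomial.degree g"
        by blast
      define q' where "q' = Polynomial.smult (b ^ k) m + q"
      have "Polynomial.smult (b ^ Suc k) f = Polynomial.smult (b ^ k) (f1 + m * g)"
        by (simp add: f1_def mult.commute)
      also have "\<dots> = q' * g + r"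
        using IH(3) by (simp add: q'_def smult_add_right algebra_simps)
      finally have eq: "Polynomial.smult (b ^ Suc k) f = q' * g + r" .
      moreover have "q' \<in> polys_over S"
        unfolding q'_def using mem IH(1) by (intro polys_closed polys_over_smult closed)
      moreover have "Polynomial.degree q' \<le> Polynomial.degree f - Polynomial.degree g"
        unfolding q'_def
      proof (rule degree_add_le)
        show "Polynomial.degree (Polynomial.smult (b ^ k) m) \<le> Polynomial.degree f - Polynomial.degree g"
          using degree_smult_le deg_m by (rule order_trans)
        show "Polynomial.degree q \<le> Polynomial.degree f - Polynomial.degree g"
          using IH(5) deg by linarith
      qed
      ultimately show ?thesis
        using IH(2,4) by blast
    qed
  qed
  then show thesis
    using that by (auto simp: b_def)
qed

end

section \<open>Finitely generated algebras modulo a prime ideal\<close>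

text \<open>
  The elements of \<open>C\<close> are read as representatives of the domain \<open>C/I\<close>, and \<open>x - y \<in> I\<close> as
  equality in it. A polynomial with coefficients in \<open>C\<close> represents the zero polynomial over \<open>C/I\<close>
  iff it lies in \<open>polys_over I\<close>. The ambient type may be larger than \<open>C\<close>, so \<open>I\<close> is an ideal of
  \<open>C\<close> only.
\<close>

locale prime_modulus = C: unital_subring C
  for C :: "'a::comm_ring_1 set" +
  fixes I :: "'a set"
  assumes I_subset: "I \<subseteq> C"
    and I_0: "0 \<in> I"
    and I_diff: "x \<in> I \<Longrightarrow> y \<in> I \<Longrightarrow> x - y \<in> I"
    and I_mult: "x \<in> C \<Longrightarrow> y \<in> I \<Longrightarrow> x * y \<in> I"
    and one_notin_I: "1 \<notin> I"
    and prime: "x \<in> C \<Longrightarrow> y \<in> C \<Longrightarrow> x * y \<in> I \<Longrightarrow> x \<in> I \<or> y \<in> I"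
begin

lemma I_uminus: "x \<in> I \<Longrightarrow> - x \<in> I"
  using I_diff[OF I_0, of x] by simp

lemma I_add: "x \<in> I \<Longrightarrow> y \<in> I \<Longrightarrow> x + y \<in> I"
  using I_diff[OF _ I_uminus[of y], of x] by simp

lemma I_mult2: "x \<in> I \<Longrightarrow> y \<in> C \<Longrightarrow> x * y \<in> I"
  using I_mult[of y x] by (simp add: mult.commute)

lemma I_sum: "(\<And>i. i \<in> T \<Longrightarrow> f i \<in> I) \<Longrightarrow> sum f T \<in> I"
  by (induction T rule: infinite_finite_induct) (auto intro: I_0 I_add)

lemma I_cong: "x - y \<in> I \<Longrightarrow> x \<in> I \<longleftrightarrow> y \<in> I"
  using I_add[of "x - y" y] I_diff[of x "x - y"] by auto

lemma prime_power: "x \<in> C \<Longrightarrow> x \<notin> I \<Longrightarrow> x ^ k \<notin> I"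
  by (induction k) (use one_notin_I prime C.power_mem in auto)

lemma polys_I_0: "0 \<in> polys_over I"
  by (simp add: polys_over_def I_0)

lemma polys_I_diff: "p \<in> polys_over I \<Longrightarrow> q \<in> polys_over I \<Longrightarrow> p - q \<in> polys_over I"
  by (simp add: polys_over_def I_diff)

lemma polys_I_add: "p \<in> polys_over I \<Longrightarrow> q \<in> polys_over I \<Longrightarrow> p + q \<in> polys_over I"
  by (simp add: polys_over_def I_add)

lemma polys_I_mult: "p \<in> polys_over C \<Longrightarrow> q \<in> polys_over I \<Longrightarrow> p * q \<in> polys_over I"
  by (auto simp: polys_over_def coeff_mult intro!: I_sum I_mult)

lemma poly_in_I: "p \<in> polys_over I \<Longrightarrow> u \<in> C \<Longrightarrow> poly p u \<in> I"
proof (induction p)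
  case 0
  then show ?case by (simp add: I_0)
next
  case (pCons c p)
  have "c \<in> I" "p \<in> polys_over I"
    using polys_over_coeff[OF pCons.prems(1), of 0] pCons.prems(1)
    by (auto simp: polys_over_def coeff_pCons split: nat.splits)
  then show ?case
    using pCons by (auto intro: I_add I_mult)
qed

text \<open>
  Coefficients that vanish in \<open>C/I\<close> are replaced by an actual \<open>0\<close>, so that \<open>degree\<close> and
  \<open>lead_coeff\<close> of the result agree with those of the polynomial over \<open>C/I\<close>.
\<close>

definition strip :: "'a poly \<Rightarrow> 'a poly" where
  "strip p = map_poly (\<lambda>c. if c \<in> I then 0 else c) p"

lemma coeff_strip: "Polynomial.coeff (strip p) i =
    (if Polynomial.coeff p i \<in> I then 0 else Polynomial.coeff p i)"
  unfolding strip_def by (subst coeff_map_poly) (auto simp: I_0)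

lemma diff_strip: "p - strip p \<in> polys_over I"
  by (simp add: polys_over_def coeff_strip I_0)

lemma degree_strip: "Polynomial.degree (strip p) \<le> Polynomial.degree p"
  by (rule degree_le) (auto simp: coeff_strip coeff_eq_0)

lemma lead_coeff_strip:
  assumes "p \<notin> polys_over I"
  shows "Polynomial.lead_coeff (strip p) \<notin> I"
proof
  assume "Polynomial.lead_coeff (strip p) \<in> I"
  then have "Polynomial.lead_coeff (strip p) = 0"
    by (auto simp: coeff_strip split: if_splits)
  then have "strip p = 0" by simp
  with diff_strip[of p] assms show False by simp
qed

lemma strip_mem:
  assumes "unital_subring S" "p \<in> polys_over S"
  shows "strip p \<in> polys_over S"
  using assms unital_subring.zero_mem[OF assms(1)] by (auto simp: polys_over_def coeff_strip)

lemma poly_strip: "u \<in> C \<Longrightarrow> poly (strip p) u \<in> I \<longleftrightarrow> poly p u \<in> I"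
  using I_cong poly_in_I[OF diff_strip] by simp blast

definition algebraic_mod :: "'a set \<Rightarrow> 'a \<Rightarrow> bool" where
  "algebraic_mod S u \<longleftrightarrow> (\<exists>p \<in> polys_over S. p \<notin> polys_over I \<and> poly p u \<in> I)"

text \<open>
  The image of \<open>S\<close> in \<open>C/I\<close> is a G-domain: the condition on \<open>r\<close> says that inverting it yields a
  field, without mentioning the localisation.
\<close>

definition G_domain_mod :: "'a set \<Rightarrow> bool" where
  "G_domain_mod S \<longleftrightarrow>
     (\<exists>r\<in>S. r \<notin> I \<and> (\<forall>f\<in>S. f \<notin> I \<longrightarrow> (\<exists>g\<in>S. \<exists>k. f * g - r ^ k \<in> I)))"

text \<open>
  Over a domain, \<open>1 + X p\<close> with \<open>p \<noteq> 0\<close> has positive degree and thus is not a unit.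
\<close>

lemma one_plus_X_mult_not_unit:
  assumes S: "unital_subring S" "S \<subseteq> C"
    and p: "p \<in> polys_over S" "p \<notin> polys_over I" and v: "v \<in> polys_over S"
  shows "pCons 1 p * v - 1 \<notin> polys_over I"
proof
  assume A: "pCons 1 p * v - 1 \<in> polys_over I"
  interpret S: unital_subring S by (fact S)
  have sub: "polys_over S \<subseteq> polys_over C" using polys_over_mono[OF S(2)] .
  have v0: "v \<notin> polys_over I"
  proof
    assume "v \<in> polys_over I"
    then have "pCons 1 p * v \<in> polys_over I"
      using sub p S.polys_over_pCons[OF S.one_mem] by (intro polys_I_mult) auto
    from polys_I_diff[OF this A] have "(1::'a poly) \<in> polys_over I"
      by (simp only: diff_diff_eq2 add_diff_cancel_left')
    then show False using polys_over_coeff[of 1 I 0] one_notin_I by simp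
  qed
  define g w where "g = pCons 1 (strip p)" and "w = strip v"
  have mem: "g \<in> polys_over C" "w \<in> polys_over C" "v \<in> polys_over C"
    using strip_mem[OF S(1)] p v sub S.polys_over_pCons[OF S.one_mem] by (auto simp: g_def w_def)
  have "strip p \<noteq> 0" using diff_strip[of p] p by auto
  then have deg_g: "Polynomial.degree g > 0" and lg: "Polynomial.lead_coeff g \<notin> I"
    using lead_coeff_strip[OF p(2)] by (auto simp: g_def)
  have lw: "Polynomial.lead_coeff w \<notin> I" using lead_coeff_strip[OF v0] by (simp add: w_def)
  have "pCons 1 p - g \<in> polys_over I" "v - w \<in> polys_over I"
    using diff_strip[of p] diff_strip[of v] I_0
    by (auto simp: g_def w_def polys_over_def coeff_pCons split: nat.split)
  then have "v * (pCons 1 p - g) + g * (v - w) \<in> polys_over I"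
    using mem by (intro polys_I_add polys_I_mult)
  then have "(pCons 1 p * v - 1) - (v * (pCons 1 p - g) + g * (v - w)) \<in> polys_over I"
    by (rule polys_I_diff[OF A])
  also have "(pCons 1 p * v - 1) - (v * (pCons 1 p - g) + g * (v - w)) = g * w - 1"
    by (simp only: algebra_simps)
  finally have "Polynomial.coeff (g * w - 1) (Polynomial.degree g + Polynomial.degree w) \<in> I"
    by (rule polys_over_coeff)
  then have "Polynomial.lead_coeff g * Polynomial.lead_coeff w \<in> I"
    using deg_g by (simp add: coeff_mult_degree_sum)
  then show False
    using prime[OF polys_over_coeff[OF mem(1)] polys_over_coeff[OF mem(2)]] lg lw by blast
qed

text \<open>
  If \<open>u\<close> were transcendental, \<open>S[u]\<close> would be a polynomial ring and the inverted element a
  polynomial \<open>p\<close>. The polynomial \<open>g = 1 + X p\<close> divides a power of \<open>p\<close>, but it is also coprime to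
  \<open>p\<close>, so it would be a unit.
\<close>

lemma G_domain_adjoin_imp_algebraic:
  assumes S: "unital_subring S" "S \<subseteq> C" and u: "u \<in> C"
    and loc: "G_domain_mod (adjoin S u)"
  shows "algebraic_mod S u"
proof (rule ccontr)
  assume "\<not> algebraic_mod S u"
  then have trans: "p \<in> polys_over I" if "p \<in> polys_over S" "poly p u \<in> I" for p
    using that by (auto simp: algebraic_mod_def)
  interpret S: unital_subring S by (fact S)
  obtain p where p: "p \<in> polys_over S" "poly p u \<notin> I"
    and inv: "\<And>f. f \<in> adjoin S u \<Longrightarrow> f \<notin> I \<Longrightarrow> \<exists>g\<in>adjoin S u. \<exists>k. f * g - poly p u ^ k \<in> I"
    using loc by (auto simp: G_domain_mod_def adjoin_def)
  define g where "g = pCons 1 p"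
  have g: "g \<in> polys_over S" using S.polys_over_pCons[OF S.one_mem] p by (simp add: g_def)
  have "poly g u \<notin> I"
    using trans[OF g] polys_over_coeff[of g I 0] one_notin_I by (auto simp: g_def)
  moreover have "poly g u \<in> adjoin S u" using g by (simp add: adjoin_def)
  ultimately obtain w k where w: "w \<in> polys_over S" "poly g u * poly w u - poly p u ^ k \<in> I"
    using inv by (force simp: adjoin_def)
  have X: "pCons 0 1 \<in> polys_over S"
    by (intro S.polys_over_pCons S.zero_mem S.polys_closed)
  \<comment> \<open>Since \<open>g - 1 = X p\<close>, this says that \<open>(X p)\<^sup>k\<close> is congruent to a unit modulo \<open>g\<close>.\<close>
  have "\<exists>t \<in> polys_over S. (g - 1) ^ k = g * t + (- 1) ^ k"
  proof (induction k)
    case 0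
    show ?case by (rule bexI[OF _ S.polys_over_0]) simp
  next
    case (Suc k)
    then obtain t where t: "t \<in> polys_over S" "(g - 1) ^ k = g * t + (- 1) ^ k" by blast
    have "(g - 1) ^ Suc k = g * ((g - 1) ^ k - t) + (- 1) ^ Suc k"
      using t(2) by (simp add: algebra_simps)
    moreover have "(g - 1) ^ k - t \<in> polys_over S"
      using t g by (intro S.polys_closed)
    ultimately show ?case by blast
  qed
  then obtain t where t: "t \<in> polys_over S" "(g - 1) ^ k = g * t + (- 1) ^ k" by blast
  define v where "v = (- 1) ^ k * (w * pCons 0 1 ^ k - t)"
  have v: "v \<in> polys_over S"
    unfolding v_def using w t X by (intro S.polys_closed)
  have "g * v - 1 = (- 1) ^ k * (g * w * pCons 0 1 ^ k - (g * t + (- 1) ^ k))"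
    by (simp add: v_def algebra_simps flip: power_mult_distrib)
  also have "g * t + (- 1) ^ k = p ^ k * pCons 0 1 ^ k"
  proof -
    have "g - 1 = p * pCons 0 1" by (simp add: g_def one_pCons)
    then show ?thesis by (simp only: t(2)[symmetric] power_mult_distrib)
  qed
  finally have "g * v - 1 = (- 1) ^ k * pCons 0 1 ^ k * (g * w - p ^ k)"
    by (simp add: algebra_simps)
  then have "poly (g * v - 1) u = ((- 1) ^ k * u ^ k) * (poly g u * poly w u - poly p u ^ k)"
    by simp
  moreover have "((- 1) ^ k * u ^ k) * (poly g u * poly w u - poly p u ^ k) \<in> I"
    using w(2) u by (intro I_mult C.closed)
  ultimately have "poly (g * v - 1) u \<in> I" by (simp only:)
  then have "g * v - 1 \<in> polys_over I"
    using g v by (intro trans S.polys_closed)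
  moreover have "p \<notin> polys_over I" using p(2) poly_in_I[OF _ u] by blast
  ultimately show False
    using one_plus_X_mult_not_unit[OF S p(1) _ v] by (simp add: g_def)
qed

end

definition adjoin_list :: "'a::comm_ring_1 set \<Rightarrow> 'a list \<Rightarrow> 'a set" where
  "adjoin_list S us = fold (\<lambda>u T. adjoin T u) us S"

context prime_modulus
begin

text \<open>
  The substitute for a minimal polynomial of \<open>u\<close> over the fraction field of \<open>S\<close>.
\<close>

lemma minimal_relation:
  assumes S: "unital_subring S" and u: "u \<in> C" and alg: "algebraic_mod S u"
  obtains m where "m \<in> polys_over S" "poly m u \<in> I"
    "Polynomial.lead_coeff m \<notin> I" "Polynomial.degree m > 0"
    "\<And>p. p \<in> polys_over S \<Longrightarrow> poly p u \<in> I \<Longrightarrow>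
      Polynomial.degree p < Polynomial.degree m \<Longrightarrow> p \<in> polys_over I"
proof -
  define P where "P p \<longleftrightarrow> p \<in> polys_over S \<and> p \<notin> polys_over I \<and> poly p u \<in> I" for p
  obtain m0 where m0: "P m0" and min: "\<And>p. P p \<Longrightarrow> Polynomial.degree m0 \<le> Polynomial.degree p"
  proof -
    obtain p where "P p" using alg by (auto simp: algebraic_mod_def P_def)
    then show thesis using that ex_has_least_nat[of P p Polynomial.degree] by blast
  qed
  define m where "m = strip m0"
  have m: "m \<in> polys_over S" "poly m u \<in> I" and lead: "Polynomial.lead_coeff m \<notin> I"
    using m0 strip_mem[OF S] poly_strip[OF u] lead_coeff_strip by (auto simp: m_def P_def)
  have "Polynomial.degree m > 0"
  proof (rule ccontr)
    assume "\<not> Polynomial.degree m > 0"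
    then obtain c where "m = [:c:]" by (auto elim: degree_eq_zeroE)
    with m lead show False by simp
  qed
  moreover have "p \<in> polys_over I"
    if "p \<in> polys_over S" "poly p u \<in> I" "Polynomial.degree p < Polynomial.degree m" for p
  proof (rule ccontr)
    assume "p \<notin> polys_over I"
    then have "Polynomial.degree m0 \<le> Polynomial.degree p" using min that by (simp add: P_def)
    then show False using that(3) degree_strip[of m0] by (simp add: m_def)
  qed
  ultimately show thesis using that m lead by blast
qed

text \<open>
  Over the fraction field of \<open>S\<close> every non-zero element \<open>a\<close> of \<open>S[u]\<close> is invertible; clearing
  denominators in the inverse gives this statement. Instead of using fractions, take among all
  polynomials \<open>f\<close> whose value at \<open>u\<close> is a non-zero multiple of \<open>a\<close> one of least degree. Division of
  \<open>f\<close> by the minimal relation \<open>m\<close> shows that \<open>f\<close> has smaller degree than \<open>m\<close>; division of \<open>m\<close> by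
  \<open>f\<close> then leaves remainder zero, and the quotient vanishes at \<open>u\<close>. If \<open>f\<close> were not constant, the
  quotient would contradict the minimality of \<open>m\<close>.
\<close>

lemma multiple_in_base:
  assumes S: "unital_subring S" "S \<subseteq> C" and u: "u \<in> C"
    and alg: "algebraic_mod S u" and a: "a \<in> adjoin S u" "a \<notin> I"
  obtains s t where "s \<in> S" "s \<notin> I" "t \<in> adjoin S u" "a * t - s \<in> I"
proof -
  interpret S: unital_subring S by (fact S)
  interpret A: unital_subring "adjoin S u" by (rule S.adjoin_subring)
  have A_C: "adjoin S u \<subseteq> C"
    by (rule S.adjoin_subset[OF S(2) C.unital_subring_axioms u])
  have evA: "poly p u \<in> adjoin S u" if "p \<in> polys_over S" for p
    using that by (simp add: adjoin_def)
  obtain m where m: "m \<in> polys_over S" "poly m u \<in> I"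
    "Polynomial.lead_coeff m \<notin> I" "Polynomial.degree m > 0"
    and min: "\<And>p. p \<in> polys_over S \<Longrightarrow> poly p u \<in> I \<Longrightarrow>
      Polynomial.degree p < Polynomial.degree m \<Longrightarrow> p \<in> polys_over I"
    using minimal_relation[OF S(1) u alg] by blast
  define Q where "Q f \<longleftrightarrow> f \<in> polys_over S \<and> poly f u \<notin> I \<and>
    (\<exists>t \<in> adjoin S u. a * t - poly f u \<in> I)" for f
  obtain p where p: "p \<in> polys_over S" "a = poly p u" using a by (auto simp: adjoin_def)
  then have "Q p"
    using a by (auto simp: Q_def I_0 intro!: bexI[of _ 1] A.one_mem)
  then obtain f0 where f0: "Q f0" and minQ: "\<And>f. Q f \<Longrightarrow> Polynomial.degree f0 \<le> Polynomial.degree f"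
    using ex_has_least_nat[of Q p Polynomial.degree] by blast
  define f where "f = strip f0"
  have f0_notin: "f0 \<notin> polys_over I" using f0 poly_in_I[OF _ u] by (auto simp: Q_def)
  have fS: "f \<in> polys_over S" and lead: "Polynomial.lead_coeff f \<notin> I" and fI: "poly f u \<notin> I"
    using f0 strip_mem[OF S(1)] lead_coeff_strip[OF f0_notin] poly_strip[OF u]
    by (auto simp: f_def Q_def)
  obtain t where t: "t \<in> adjoin S u" "a * t - poly f u \<in> I"
  proof -
    obtain t where t: "t \<in> adjoin S u" "a * t - poly f0 u \<in> I" using f0 by (auto simp: Q_def)
    have "a * t - poly f u = (a * t - poly f0 u) + poly (f0 - f) u" by simp
    also have "\<dots> \<in> I" unfolding f_def by (intro I_add t poly_in_I diff_strip u)
    finally show thesis using that t by blast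
  qed
  have minf: "poly r u \<in> I" if "r \<in> polys_over S" "Polynomial.degree r < Polynomial.degree f"
    "t' \<in> adjoin S u" "a * t' - poly r u \<in> I" for r t'
  proof (rule ccontr)
    assume "poly r u \<notin> I"
    then have "Q r" unfolding Q_def using that by blast
    then show False using minQ[of r] that(2) degree_strip[of f0] by (simp add: f_def)
  qed
  have f_nz: "f \<noteq> 0" and m_nz: "m \<noteq> 0" using lead m I_0 by auto
  have le: "Polynomial.degree f < Polynomial.degree m"
  proof (rule ccontr)
    assume "\<not> ?thesis"
    then have le: "Polynomial.degree m \<le> Polynomial.degree f" by simp
    define c where "c = Polynomial.lead_coeff m"
    have cS: "c \<in> S" using m polys_over_coeff by (auto simp: c_def)
    obtain k q r where d: "q \<in> polys_over S" "r \<in> polys_over S"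
      "Polynomial.smult (c ^ k) f = q * m + r" "r = 0 \<or> Polynomial.degree r < Polynomial.degree m"
      unfolding c_def by (rule S.pseudo_division[OF fS m(1) m_nz])
    from arg_cong[OF d(3), of "\<lambda>p. poly p u"]
    have ev: "c ^ k * poly f u = poly q u * poly m u + poly r u" by simp
    have qC: "poly q u \<in> C" using evA d A_C by blast
    have ckC: "c ^ k \<in> C" using cS S(2) by (auto intro: C.power_mem)
    have qm: "poly q u * poly m u \<in> I" by (rule I_mult[OF qC m(2)])
    have "a * (c ^ k * t) - poly r u = c ^ k * (a * t - poly f u) + poly q u * poly m u"
      using ev by (simp add: algebra_simps)
    also have "\<dots> \<in> I" by (intro I_add I_mult qm t ckC)
    finally have tr: "a * (c ^ k * t) - poly r u \<in> I" .
    have ct: "c ^ k * t \<in> adjoin S u"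
      using S.subset_adjoin[of u] cS t by (auto intro!: A.closed)
    have "poly r u \<in> I"
    proof (cases "r = 0")
      case False
      with d(4) le have "Polynomial.degree r < Polynomial.degree f" by simp
      with minf[OF d(2) _ ct tr] show ?thesis by blast
    qed (simp add: I_0)
    then have "c ^ k * poly f u \<in> I" unfolding ev by (intro I_add qm)
    moreover have "c ^ k \<notin> I" using prime_power[of c k] cS S(2) m by (auto simp: c_def)
    ultimately show False using prime[OF ckC] evA[OF fS] A_C fI by blast
  qed
  have "Polynomial.degree f = 0"
  proof (rule ccontr)
    assume pos: "Polynomial.degree f \<noteq> 0"
    define b where "b = Polynomial.lead_coeff f"
    have bS: "b \<in> S" using fS polys_over_coeff by (auto simp: b_def)
    obtain k q r where d: "q \<in> polys_over S" "r \<in> polys_over S"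
      "Polynomial.smult (b ^ k) m = q * f + r" "r = 0 \<or> Polynomial.degree r < Polynomial.degree f"
      "Polynomial.degree q \<le> Polynomial.degree m - Polynomial.degree f"
      unfolding b_def by (rule S.pseudo_division[OF m(1) fS f_nz])
    from arg_cong[OF d(3), of "\<lambda>p. poly p u"]
    have ev: "b ^ k * poly m u = poly q u * poly f u + poly r u" by simp
    have qA: "poly q u \<in> adjoin S u" using evA d by blast
    have bkC: "b ^ k \<in> C" using bS S(2) by (auto intro: C.power_mem)
    have bm: "b ^ k * poly m u \<in> I" by (rule I_mult[OF bkC m(2)])
    have "a * (- poly q u * t) - poly r u = - poly q u * (a * t - poly f u) - b ^ k * poly m u"
      using ev by (simp add: algebra_simps)
    also have "\<dots> \<in> I"
      using qA A_C by (intro I_diff I_mult bm t C.uminus_mem) auto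
    finally have tr: "a * (- poly q u * t) - poly r u \<in> I" .
    have rI: "poly r u \<in> I"
    proof (cases "r = 0")
      case False
      with d(4) have "Polynomial.degree r < Polynomial.degree f" by simp
      with minf[OF d(2) _ _ tr] qA t show ?thesis by (auto intro: A.closed)
    qed (simp add: I_0)
    have r: "r \<in> polys_over I"
      using d(4) le min[OF d(2) rI] polys_I_0 by force
    have "poly q u * poly f u = b ^ k * poly m u - poly r u" using ev by simp
    also have "\<dots> \<in> I" by (intro I_diff bm rI)
    finally have "poly q u \<in> I"
      using prime evA[OF fS] qA A_C fI by blast
    moreover have "Polynomial.degree q < Polynomial.degree m" using d(5) m(4) pos by linarith
    ultimately have q: "q \<in> polys_over I" using min[OF d(1)] by blast
    have fC: "f \<in> polys_over C" using fS polys_over_mono[OF S(2)] by blast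
    have "f * q + r \<in> polys_over I" by (intro polys_I_add polys_I_mult q r fC)
    then have "Polynomial.smult (b ^ k) m \<in> polys_over I" by (simp add: d(3) mult.commute)
    from polys_over_coeff[OF this, of "Polynomial.degree m"]
    have "b ^ k * Polynomial.lead_coeff m \<in> I" by simp
    moreover have "b ^ k \<notin> I" using prime_power[of b k] bS S(2) lead by (auto simp: b_def)
    moreover have "Polynomial.lead_coeff m \<in> C" using m polys_over_coeff S(2) by blast
    ultimately show False using prime[OF bkC] m(3) by blast
  qed
  then obtain s where s: "f = [:s:]" by (auto elim: degree_eq_zeroE)
  then have "s \<in> S" "s \<notin> I" "a * t - s \<in> I"
    using polys_over_coeff[OF fS, of 0] fI t by auto
  with that t show thesis by blast
qed

text \<open>
  If inverting \<open>a\<close> makes \<open>S[u]\<close> a field, and \<open>s\<close> in \<open>S\<close> is a non-zero multiple of \<open>a\<close>, then it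
  suffices to invert \<open>c s\<close> in \<open>S\<close>, where \<open>c\<close> is the leading coefficient of the minimal relation.
  After inverting \<open>c\<close>, the ring \<open>S[u]\<close> is free over \<open>S\<close> with the powers of \<open>u\<close> below the degree of
  that relation as a basis, and comparing the coefficients of \<open>u\<^sup>0\<close> turns an inverse of \<open>x \<in> S\<close>
  found in \<open>S[u]\<close> into one in \<open>S\<close>.
\<close>

lemma G_domain_descends:
  assumes S: "unital_subring S" "S \<subseteq> C" and u: "u \<in> C"
    and loc: "G_domain_mod (adjoin S u)"
  shows "G_domain_mod S"
proof -
  interpret S: unital_subring S by (fact S)
  interpret A: unital_subring "adjoin S u" by (rule S.adjoin_subring)
  have A_C: "adjoin S u \<subseteq> C"
    by (rule S.adjoin_subset[OF S(2) C.unital_subring_axioms u])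
  have alg: "algebraic_mod S u" by (rule G_domain_adjoin_imp_algebraic[OF assms])
  obtain m where m: "m \<in> polys_over S" "poly m u \<in> I"
    "Polynomial.lead_coeff m \<notin> I" "Polynomial.degree m > 0"
    and min: "\<And>p. p \<in> polys_over S \<Longrightarrow> poly p u \<in> I \<Longrightarrow>
      Polynomial.degree p < Polynomial.degree m \<Longrightarrow> p \<in> polys_over I"
    using minimal_relation[OF S(1) u alg] by blast
  obtain a where a: "a \<in> adjoin S u" "a \<notin> I"
    and inv: "\<And>f. f \<in> adjoin S u \<Longrightarrow> f \<notin> I \<Longrightarrow> \<exists>g\<in>adjoin S u. \<exists>k. f * g - a ^ k \<in> I"
    using loc by (auto simp: G_domain_mod_def)
  obtain s t where st: "s \<in> S" "s \<notin> I" "t \<in> adjoin S u" "a * t - s \<in> I"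
    using multiple_in_base[OF S u alg a] by blast
  define c where "c = Polynomial.lead_coeff m"
  have c: "c \<in> S" "c \<notin> I" using m polys_over_coeff by (auto simp: c_def)
  have m_nz: "m \<noteq> 0" using m I_0 by auto
  have SC: "x \<in> C" if "x \<in> S" for x using that S(2) by blast
  have "c * s \<in> S" using c st by (intro S.closed)
  moreover have "c * s \<notin> I" using prime c st SC by blast
  moreover have "\<exists>g\<in>S. \<exists>k. x * g - (c * s) ^ k \<in> I" if x: "x \<in> S" "x \<notin> I" for x
  proof -
    have "x \<in> adjoin S u" using S.subset_adjoin x by blast
    then obtain h k where h: "h \<in> adjoin S u" "x * h - a ^ k \<in> I" using inv x by blast
    have tC: "t \<in> C" "s \<in> C" "a \<in> C" using a st A_C SC by auto
    have "(a * t) ^ k - s ^ k = (a * t - s) * (\<Sum>i<k. s ^ (k - Suc i) * (a * t) ^ i)"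
      by (rule power_diff_sumr2)
    moreover have "(\<Sum>i<k. s ^ (k - Suc i) * (a * t) ^ i) \<in> C"
      using tC by (intro C.sum_mem C.closed)
    ultimately have "(a * t) ^ k - s ^ k \<in> I"
      using I_mult2[OF st(4)] by simp
    moreover have "t ^ k * (x * h - a ^ k) \<in> I"
      using tC h by (intro I_mult C.closed)
    ultimately have "t ^ k * (x * h - a ^ k) + ((a * t) ^ k - s ^ k) \<in> I" by (intro I_add)
    then have 1: "x * (h * t ^ k) - s ^ k \<in> I"
      by (simp add: algebra_simps power_mult_distrib)
    have "h * t ^ k \<in> adjoin S u" using h st by (intro A.closed)
    then obtain w where w: "w \<in> polys_over S" "poly w u = h * t ^ k" by (auto simp: adjoin_def)
    obtain j q r where d: "q \<in> polys_over S" "r \<in> polys_over S"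
      "Polynomial.smult (c ^ j) w = q * m + r" "r = 0 \<or> Polynomial.degree r < Polynomial.degree m"
      unfolding c_def by (rule S.pseudo_division[OF w(1) m(1) m_nz])
    from arg_cong[OF d(3), of "\<lambda>p. poly p u"]
    have ev: "c ^ j * poly w u = poly q u * poly m u + poly r u" by simp
    define v where "v = Polynomial.smult x r - [:c ^ j * s ^ k:]"
    have "poly v u = c ^ j * (x * poly w u - s ^ k) - (x * poly q u) * poly m u"
      using ev by (simp add: v_def algebra_simps)
    also have "\<dots> \<in> I"
    proof (rule I_diff)
      have "c ^ j \<in> C" using c SC by (intro C.closed)
      then show "c ^ j * (x * poly w u - s ^ k) \<in> I" using 1 w by (intro I_mult) simp_all
      have "poly q u \<in> C" using d A_C by (auto simp: adjoin_def)
      then have "x * poly q u \<in> C" using x SC by (intro C.closed)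
      then show "x * poly q u * poly m u \<in> I" using m by (intro I_mult)
    qed
    finally have vI: "poly v u \<in> I" .
    have vS: "v \<in> polys_over S"
      unfolding v_def using x c st d
      by (intro S.polys_closed S.polys_over_smult S.polys_over_const S.closed)
    have "Polynomial.degree v < Polynomial.degree m"
    proof -
      have "Polynomial.degree (Polynomial.smult x r) < Polynomial.degree m"
        using d(4) m(4) degree_smult_le[of x r] by auto
      then show ?thesis unfolding v_def using m(4) by (intro degree_diff_less) auto
    qed
    then have "v \<in> polys_over I" by (rule min[OF vS vI])
    from polys_over_coeff[OF this, of 0]
    have "x * Polynomial.coeff r 0 - c ^ j * s ^ k \<in> I" by (simp add: v_def)
    moreover have "c ^ k * s ^ j \<in> C" using c st SC by (intro C.closed)
    ultimately have "(c ^ k * s ^ j) * (x * Polynomial.coeff r 0 - c ^ j * s ^ k) \<in> I"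
      by (rule I_mult[rotated])
    then have "x * (Polynomial.coeff r 0 * (c ^ k * s ^ j)) - (c * s) ^ (j + k) \<in> I"
      by (simp add: algebra_simps power_add power_mult_distrib)
    moreover have "Polynomial.coeff r 0 * (c ^ k * s ^ j) \<in> S"
      using c st polys_over_coeff[OF d(2)] by (intro S.closed)
    ultimately show ?thesis by blast
  qed
  ultimately show ?thesis unfolding G_domain_mod_def by blast
qed

lemma G_domain_descends_list:
  assumes S: "unital_subring S" "S \<subseteq> C" and us: "set us \<subseteq> C"
    and loc: "G_domain_mod (adjoin_list S us)"
  shows "G_domain_mod S"
  using assms
proof (induction us arbitrary: S)
  case Nil
  then show ?case by (simp add: adjoin_list_def)
next
  case (Cons u us)
  interpret S: unital_subring S by (fact Cons)
  have u: "u \<in> C" using Cons.prems by simp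
  have "G_domain_mod (adjoin S u)"
  proof (rule Cons.IH[OF S.adjoin_subring])
    show "adjoin S u \<subseteq> C"
      by (rule S.adjoin_subset[OF Cons.prems(2) C.unital_subring_axioms u])
  qed (use Cons.prems in \<open>simp_all add: adjoin_list_def\<close>)
  with Cons.prems(1,2) u show ?case by (rule G_domain_descends)
qed

text \<open>
  The generator adjoined first is the last one to be removed, and at that point only \<open>S\<close> is left.
\<close>

lemma first_generator_algebraic:
  assumes S: "unital_subring S" "S \<subseteq> C" and us: "set (u # us) \<subseteq> C"
    and loc: "G_domain_mod (adjoin_list S (u # us))"
  shows "algebraic_mod S u"
proof -
  interpret S: unital_subring S by (fact S)
  have u: "u \<in> C" using us by simp
  have "G_domain_mod (adjoin S u)"
  proof (rule G_domain_descends_list[OF S.adjoin_subring])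
    show "adjoin S u \<subseteq> C"
      by (rule S.adjoin_subset[OF S(2) C.unital_subring_axioms u])
  qed (use us loc in \<open>simp_all add: adjoin_list_def\<close>)
  with S u show ?thesis by (rule G_domain_adjoin_imp_algebraic)
qed

end

lemma adjoin_list_subring:
  "unital_subring S \<Longrightarrow> unital_subring (adjoin_list S us)"
proof (induction us arbitrary: S)
  case (Cons u us)
  show ?case
    using Cons.IH[OF unital_subring.adjoin_subring[OF Cons.prems]] by (simp add: adjoin_list_def)
qed (simp add: adjoin_list_def)

lemma subset_adjoin_list:
  "unital_subring S \<Longrightarrow> S \<union> set us \<subseteq> adjoin_list S us"
proof (induction us arbitrary: S)
  case (Cons u us)
  interpret S: unital_subring S by fact
  have "adjoin S u \<union> set us \<subseteq> adjoin_list S (u # us)"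
    using Cons.IH[OF S.adjoin_subring[of u]] by (simp add: adjoin_list_def)
  then show ?case
    using S.subset_adjoin[of u] S.generator_in_adjoin[of u] by auto
qed (simp add: adjoin_list_def)

lemma adjoin_list_subset:
  "unital_subring S \<Longrightarrow> S \<union> set us \<subseteq> T \<Longrightarrow> unital_subring T \<Longrightarrow> adjoin_list S us \<subseteq> T"
proof (induction us arbitrary: S)
  case (Cons u us)
  interpret S: unital_subring S by fact
  have "adjoin S u \<subseteq> T"
    using Cons.prems by (intro S.adjoin_subset) auto
  then show ?case
    using Cons.IH[OF S.adjoin_subring, of u] Cons.prems by (simp add: adjoin_list_def)
qed (simp add: adjoin_list_def)

section \<open>The polynomial ring and its residue classes\<close>

lemma mpoly_ring_simps [simp]:
  "x \<otimes>\<^bsub>mpoly_ring n\<^esub> y = x * y" "x \<oplus>\<^bsub>mpoly_ring n\<^esub> y = x + y"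
  "\<one>\<^bsub>mpoly_ring n\<^esub> = 1" "\<zero>\<^bsub>mpoly_ring n\<^esub> = 0"
  by (simp_all add: mpoly_ring_def ring_of_type_algebra_def)

lemma mem_mpoly_ring: "p \<in> carrier (mpoly_ring n) \<longleftrightarrow>
    (\<forall>m \<in> Poly_Mapping.keys p. Poly_Mapping.keys m \<subseteq> {1..n})"
  by (simp add: mpoly_ring_def)

lemma carrier_subring: "unital_subring (carrier (mpoly_ring n) :: 'k::field mpoly set)"
proof
  show "1 \<in> (carrier (mpoly_ring n) :: 'k mpoly set)"
    by (simp add: mem_mpoly_ring)
next
  fix x y :: "'k mpoly"
  assume xy: "x \<in> carrier (mpoly_ring n)" "y \<in> carrier (mpoly_ring n)"
  have "Poly_Mapping.keys (x - y) \<subseteq> Poly_Mapping.keys x \<union> Poly_Mapping.keys y"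
    by (auto simp: in_keys_iff lookup_minus)
  with xy show "x - y \<in> carrier (mpoly_ring n)"
    by (fastforce simp: mem_mpoly_ring)
  show "x * y \<in> carrier (mpoly_ring n)"
    unfolding mem_mpoly_ring
  proof
    fix m assume "m \<in> Poly_Mapping.keys (x * y)"
    then obtain a b where "m = a + b" "a \<in> Poly_Mapping.keys x" "b \<in> Poly_Mapping.keys y"
      using keys_mult[of x y] by blast
    then show "Poly_Mapping.keys m \<subseteq> {1..n}"
      using xy Poly_Mapping.keys_add[of a b] by (fastforce simp: mem_mpoly_ring)
  qed
qed

lemma cring_mpoly_ring: "cring (mpoly_ring n)"
proof (rule cringI)
  interpret C: unital_subring "carrier (mpoly_ring n)" by (rule carrier_subring)
  show "abelian_group (mpoly_ring n)"
  proof (rule abelian_groupI)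
    fix x assume "x \<in> carrier (mpoly_ring n)"
    then show "\<exists>y\<in>carrier (mpoly_ring n). y \<oplus>\<^bsub>mpoly_ring n\<^esub> x = \<zero>\<^bsub>mpoly_ring n\<^esub>"
      by (intro bexI[of _ "- x"]) (auto intro: C.closed)
  qed (auto intro: C.closed simp: algebra_simps)
  show "Group.comm_monoid (mpoly_ring n)"
    by (rule comm_monoidI) (auto intro: C.closed simp: algebra_simps)
qed (simp add: algebra_simps)

lemma minus_mpoly_ring [simp]:
  assumes "x \<in> carrier (mpoly_ring n)" "y \<in> carrier (mpoly_ring n)"
  shows "x \<ominus>\<^bsub>mpoly_ring n\<^esub> y = x - y"
proof -
  interpret P: cring "mpoly_ring n" by (rule cring_mpoly_ring)
  have "\<ominus>\<^bsub>mpoly_ring n\<^esub> y = - y"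
    using assms unital_subring.uminus_mem[OF carrier_subring, of y]
    by (intro P.minus_equality) auto
  then show ?thesis by (simp add: a_minus_def)
qed

lemma Const_hom [simp]:
  "Const 0 = 0" "Const 1 = 1" "Const (a + b) = Const a + Const b"
  "Const (a - b) = Const a - Const b" "Const (a * b) = Const a * Const b"
  "Const (- a) = - Const a"
  by (simp_all add: Const_def single_add single_diff single_uminus mult_single)

lemma Const_sum: "Const (sum f T) = (\<Sum>i\<in>T. Const (f i))"
  by (induction T rule: infinite_finite_induct) auto

lemma Const_power: "Const (a ^ k) = Const a ^ k"
  by (induction k) auto

lemma Const_mem: "Const c \<in> carrier (mpoly_ring n)"
  by (auto simp: mem_mpoly_ring Const_def split: if_splits)

lemma Var_mem: "i \<in> {1..n} \<Longrightarrow> Var i \<in> carrier (mpoly_ring n)"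
  by (auto simp: mem_mpoly_ring Var_def split: if_splits)

lemma Const_range_subring: "unital_subring (range (Const :: 'k::field \<Rightarrow> _))"
proof
  show "1 \<in> range (Const :: 'k::field \<Rightarrow> _)" by (rule range_eqI[of _ _ 1]) simp
next
  fix x y :: "'k mpoly" assume "x \<in> range Const" "y \<in> range Const"
  then obtain a b where "x = Const a" "y = Const b" by blast
  then have "x - y = Const (a - b)" "x * y = Const (a * b)" by simp_all
  then show "x - y \<in> range Const" "x * y \<in> range Const" by blast+
qed

text \<open>
  Properties that hold for constants and indeterminates and are stable under ring operations
  extend to all polynomials. This is how generation of \<open>P/I\<close> by the indeterminates is used.
\<close>

lemma carrier_generated:
  assumes T: "unital_subring T" and const: "range Const \<subseteq> T"
    and var: "\<And>i. i \<in> {1..n} \<Longrightarrow> Var i \<in> T"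
  shows "carrier (mpoly_ring n) \<subseteq> T"
proof
  interpret T: unital_subring T by (fact T)
  have power: "Poly_Mapping.single (Poly_Mapping.single i k) 1 = (Var i :: 'a mpoly) ^ k" for i k
  proof (induction k)
    case (Suc k)
    have "Poly_Mapping.single (Poly_Mapping.single i (Suc k)) (1::'a) =
        Var i * Poly_Mapping.single (Poly_Mapping.single i k) 1"
      by (simp add: Var_def mult_single flip: single_add)
    then show ?case using Suc by simp
  qed simp
  have monom: "Poly_Mapping.single m (1::'a) \<in> T" if "Poly_Mapping.keys m \<subseteq> {1..n}" for m
  proof -
    have "Poly_Mapping.single (\<Sum>i\<in>A. Poly_Mapping.single i (Poly_Mapping.lookup m i)) (1::'a) \<in> T"
      if "finite A" "A \<subseteq> {1..n}" for A
      using that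
    proof (induction A)
      case (insert i A)
      have "Poly_Mapping.single (\<Sum>i\<in>insert i A. Poly_Mapping.single i (Poly_Mapping.lookup m i)) (1::'a)
        = Var i ^ Poly_Mapping.lookup m i *
          Poly_Mapping.single (\<Sum>i\<in>A. Poly_Mapping.single i (Poly_Mapping.lookup m i)) 1"
        using insert by (simp add: mult_single flip: power)
      moreover have "Var i ^ Poly_Mapping.lookup m i \<in> T"
        using insert.prems by (intro T.power_mem var) auto
      ultimately show ?case using insert by (auto intro: T.mult_mem)
    qed (simp add: T.one_mem)
    moreover have "(\<Sum>i\<in>Poly_Mapping.keys m. Poly_Mapping.single i (Poly_Mapping.lookup m i)) = m"
      by (rule poly_mapping_eqI)
        (auto simp: lookup_sum lookup_single when_def sum.delta' in_keys_iff)
    ultimately show ?thesis using that finite_keys[of m] by metis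
  qed
  fix p :: "'a mpoly" assume p: "p \<in> carrier (mpoly_ring n)"
  have "p = (\<Sum>m\<in>Poly_Mapping.keys p. Poly_Mapping.single m (Poly_Mapping.lookup p m))"
    by (rule poly_mapping_eqI)
      (auto simp: lookup_sum lookup_single when_def sum.delta' in_keys_iff)
  also have "\<dots> = (\<Sum>m\<in>Poly_Mapping.keys p. Const (Poly_Mapping.lookup p m) * Poly_Mapping.single m 1)"
    by (simp add: Const_def mult_single)
  also have "\<dots> \<in> T"
    using p const by (intro T.sum_mem T.mult_mem monom) (auto simp: mem_mpoly_ring)
  finally show "p \<in> T" .
qed

text \<open>
  The substitution homomorphism \<open>K[z] \<rightarrow> P\<close>, \<open>z \<mapsto> f\<close>, whose composition with the residue
  map has the minimal polynomial of \<open>f\<close> as generator of its kernel.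
\<close>

definition ev :: "'k::field mpoly \<Rightarrow> 'k poly \<Rightarrow> 'k mpoly" where
  "ev f g = poly (map_poly Const g) f"

lemma coeff_map_Const [simp]: "Polynomial.coeff (map_poly Const g) i = Const (Polynomial.coeff g i)"
  by (simp add: coeff_map_poly)

lemma ev_simps [simp]:
  "ev f 0 = 0" "ev f 1 = 1" "ev f (pCons c g) = Const c + f * ev f g"
  "ev f (g + h) = ev f g + ev f h" "ev f (g - h) = ev f g - ev f h"
  "ev f (g * h) = ev f g * ev f h"
proof -
  have "map_poly Const (g + h) = map_poly Const g + map_poly Const h"
    "map_poly Const (g - h) = map_poly Const g - map_poly Const h"
    "map_poly Const (g * h) = map_poly Const g * map_poly Const h"
    by (auto intro!: poly_eqI simp: coeff_mult Const_sum)
  then show "ev f (g + h) = ev f g + ev f h" "ev f (g - h) = ev f g - ev f h"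
    "ev f (g * h) = ev f g * ev f h"
    by (simp_all add: ev_def)
qed (simp_all add: ev_def map_poly_pCons)

lemma ev_power [simp]: "ev f (g ^ k) = ev f g ^ k"
  by (induction k) auto

lemma ev_prod: "ev f (prod g T) = (\<Prod>i\<in>T. ev f (g i))"
  by (induction T rule: infinite_finite_induct) auto

lemma ev_mem:
  assumes "f \<in> carrier (mpoly_ring n)"
  shows "ev f g \<in> carrier (mpoly_ring n)"
  unfolding ev_def
  by (rule unital_subring.poly_mem[OF carrier_subring])
    (use assms in \<open>auto simp: polys_over_def intro: Const_mem\<close>)

locale mpoly_ideal =
  fixes n :: nat and I :: "'k::field mpoly set"
  assumes ideal: "ideal I (mpoly_ring n)"
begin

abbreviation P where "P \<equiv> carrier (mpoly_ring n) :: 'k mpoly set"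
abbreviation R where "R \<equiv> residue_alg n I"
abbreviation cls where "cls f \<equiv> I +>\<^bsub>mpoly_ring n\<^esub> f"
abbreviation K where "K \<equiv> scalars n I"

sublocale P: unital_subring P
  by (rule carrier_subring)

sublocale R: cring R
  by (rule ideal.quotient_is_cring[OF ideal cring_mpoly_ring])

lemma I_subset_P: "I \<subseteq> P"
  using ideal.Icarr[OF ideal] by blast

lemma ideal_closed:
  shows ideal_0: "0 \<in> I"
    and ideal_mult: "x \<in> P \<Longrightarrow> y \<in> I \<Longrightarrow> x * y \<in> I"
    and ideal_diff: "x \<in> I \<Longrightarrow> y \<in> I \<Longrightarrow> x - y \<in> I"
    and ideal_add: "x \<in> I \<Longrightarrow> y \<in> I \<Longrightarrow> x + y \<in> I"
proof -
  interpret ideal I "mpoly_ring n" by (rule ideal)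
  show "0 \<in> I" using additive_subgroup.zero_closed[OF additive_subgroup_axioms] by simp
  show "x \<in> P \<Longrightarrow> y \<in> I \<Longrightarrow> x * y \<in> I" for x y using I_l_closed[of y x] by simp
  show "x \<in> I \<Longrightarrow> y \<in> I \<Longrightarrow> x + y \<in> I" for x y using additive_subgroup.a_closed[OF additive_subgroup_axioms, of x y] by simp
  show "x \<in> I \<Longrightarrow> y \<in> I \<Longrightarrow> x - y \<in> I" for x y
    using additive_subgroup.a_closed[OF additive_subgroup_axioms, of x "\<ominus>\<^bsub>mpoly_ring n\<^esub> y"]
      additive_subgroup.a_inv_closed[OF additive_subgroup_axioms, of y] minus_mpoly_ring[of x n y] Icarr
    by (simp add: a_minus_def)
qed

lemma cls_eq_iff: "f \<in> P \<Longrightarrow> g \<in> P \<Longrightarrow> cls f = cls g \<longleftrightarrow> f - g \<in> I"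
  using ring.quotient_eq_iff_same_a_r_cos[OF cring.axioms(1)[OF cring_mpoly_ring] ideal] by simp

lemma cls_hom:
  shows cls_mem [simp]: "f \<in> P \<Longrightarrow> cls f \<in> carrier R"
    and cls_add: "f \<in> P \<Longrightarrow> g \<in> P \<Longrightarrow> cls f \<oplus>\<^bsub>R\<^esub> cls g = cls (f + g)"
    and cls_mult: "f \<in> P \<Longrightarrow> g \<in> P \<Longrightarrow> cls f \<otimes>\<^bsub>R\<^esub> cls g = cls (f * g)"
    and cls_one: "\<one>\<^bsub>R\<^esub> = cls 1"
  using ring_hom_memE[OF ideal.rcos_ring_hom[OF ideal]] by auto

lemma cls_zero: "\<zero>\<^bsub>R\<^esub> = cls 0"
  using ring.a_rcos_zero[OF cring.axioms(1)[OF cring_mpoly_ring] ideal ideal_0]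
  by (simp add: FactRing_def)

lemma cls_eq_zero: "f \<in> P \<Longrightarrow> cls f = \<zero>\<^bsub>R\<^esub> \<longleftrightarrow> f \<in> I"
  using cls_eq_iff[of f 0] P.zero_mem by (simp add: cls_zero)

lemma cls_uminus: "f \<in> P \<Longrightarrow> \<ominus>\<^bsub>R\<^esub> cls f = cls (- f)"
  using P.uminus_mem[of f] by (intro R.minus_equality) (auto simp: cls_add cls_zero)

lemma cls_minus: "f \<in> P \<Longrightarrow> g \<in> P \<Longrightarrow> cls f \<ominus>\<^bsub>R\<^esub> cls g = cls (f - g)"
  using P.uminus_mem[of g] by (simp add: a_minus_def cls_uminus cls_add)

lemma cls_power: "f \<in> P \<Longrightarrow> cls f [^]\<^bsub>R\<^esub> (k::nat) = cls (f ^ k)"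
  by (induction k) (auto simp: cls_one cls_mult P.power_mem mult.commute)

lemma carrier_R: "carrier R = cls ` P"
  by (auto simp: FactRing_def A_RCOSETS_def' )

lemma R_trivial_iff: "carrier R = {\<zero>\<^bsub>R\<^esub>} \<longleftrightarrow> 1 \<in> I"
  using R.carrier_one_zero cls_eq_zero[OF P.one_mem] by (simp add: cls_one)

lemma K_subset: "K \<subseteq> carrier R"
  by (auto simp: scalars_def Const_mem)

lemma K_iff: "x \<in> K \<longleftrightarrow> (\<exists>c. x = cls (Const c))"
  by (auto simp: scalars_def)

lemma K_subfield:
  assumes "1 \<notin> I"
  shows "subfield K R"
proof (rule R.subfieldI)
  show "subcring K R"
  proof (rule R.subcringI')
    show "subring K R"
    proof (rule R.subringI[OF K_subset])
      show "\<one>\<^bsub>R\<^esub> \<in> K" unfolding K_iff cls_one by (rule exI[of _ 1]) simp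
    next
      fix h assume "h \<in> K"
      then obtain c where "h = cls (Const c)" by (auto simp: K_iff)
      then have "\<ominus>\<^bsub>R\<^esub> h = cls (Const (- c))"
        by (simp add: cls_uminus Const_mem)
      then show "\<ominus>\<^bsub>R\<^esub> h \<in> K" unfolding K_iff by blast
    next
      fix h h' assume "h \<in> K" "h' \<in> K"
      then obtain c c' where "h = cls (Const c)" "h' = cls (Const c')" by (auto simp: K_iff)
      then have "h \<otimes>\<^bsub>R\<^esub> h' = cls (Const (c * c'))" "h \<oplus>\<^bsub>R\<^esub> h' = cls (Const (c + c'))"
        by (simp_all add: cls_mult cls_add Const_mem)
      then show "h \<otimes>\<^bsub>R\<^esub> h' \<in> K" "h \<oplus>\<^bsub>R\<^esub> h' \<in> K" unfolding K_iff by blast+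
    qed
  qed
next
  have one_ne: "\<one>\<^bsub>R\<^esub> \<noteq> \<zero>\<^bsub>R\<^esub>" using assms cls_eq_zero[OF P.one_mem] by (simp add: cls_one)
  show "Units (R\<lparr>carrier := K\<rparr>) = K - {\<zero>\<^bsub>R\<^esub>}"
  proof
    show "Units (R\<lparr>carrier := K\<rparr>) \<subseteq> K - {\<zero>\<^bsub>R\<^esub>}"
      using K_subset one_ne by (auto simp: Units_def)
    show "K - {\<zero>\<^bsub>R\<^esub>} \<subseteq> Units (R\<lparr>carrier := K\<rparr>)"
    proof
      fix x assume "x \<in> K - {\<zero>\<^bsub>R\<^esub>}"
      then obtain c where c: "x = cls (Const c)" "x \<noteq> \<zero>\<^bsub>R\<^esub>" by (auto simp: K_iff)
      then have "c \<noteq> 0" by (auto simp: cls_zero)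
      then have "x \<otimes>\<^bsub>R\<^esub> cls (Const (inverse c)) = \<one>\<^bsub>R\<^esub>" "cls (Const (inverse c)) \<otimes>\<^bsub>R\<^esub> x = \<one>\<^bsub>R\<^esub>"
        unfolding c cls_one by (simp_all add: cls_mult Const_mem flip: Const_hom(5))
      then show "x \<in> Units (R\<lparr>carrier := K\<rparr>)"
        unfolding Units_def using c(1)
        by (auto simp: K_iff intro!: bexI[of _ "cls (Const (inverse c))"])
    qed
  qed
qed

lemma zero_dimensional_iff:
  "zero_dimensional n I \<longleftrightarrow> 1 \<notin> I \<and> R.finite_dimension K (carrier R)"
  by (simp add: zero_dimensional_def R_trivial_iff)

lemma maximal_iff:
  "maximalideal I (mpoly_ring n) \<longleftrightarrow> 1 \<notin> I \<and> (\<forall>f\<in>P. f \<notin> I \<longrightarrow> (\<exists>g\<in>P. f * g - 1 \<in> I))"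
proof
  assume max: "maximalideal I (mpoly_ring n)"
  interpret F: field R by (rule maximalideal.quotient_is_field[OF max cring_mpoly_ring])
  have "1 \<notin> I" using F.one_not_zero cls_eq_zero[OF P.one_mem] by (simp add: cls_one)
  moreover have "\<exists>g\<in>P. f * g - 1 \<in> I" if f: "f \<in> P" "f \<notin> I" for f
  proof -
    have "cls f \<in> Units R" using f cls_eq_zero by (simp add: F.field_Units)
    then obtain y where "y \<in> carrier R" "cls f \<otimes>\<^bsub>R\<^esub> y = \<one>\<^bsub>R\<^esub>" by (auto simp: Units_def)
    then obtain g where "g \<in> P" "cls f \<otimes>\<^bsub>R\<^esub> cls g = cls 1" by (auto simp: carrier_R cls_one)
    then show ?thesis
      using f cls_eq_iff[of "f * g" 1] P.closed by (auto simp: cls_mult)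
  qed
  ultimately show "1 \<notin> I \<and> (\<forall>f\<in>P. f \<notin> I \<longrightarrow> (\<exists>g\<in>P. f * g - 1 \<in> I))" by blast
next
  assume A: "1 \<notin> I \<and> (\<forall>f\<in>P. f \<notin> I \<longrightarrow> (\<exists>g\<in>P. f * g - 1 \<in> I))"
  show "maximalideal I (mpoly_ring n)"
  proof (rule maximalidealI[OF ideal])
    show "P \<noteq> I" using A P.one_mem by blast
    fix J assume J: "ideal J (mpoly_ring n)" "I \<subseteq> J" "J \<subseteq> P"
    interpret J: mpoly_ideal n J by (rule mpoly_ideal.intro) (fact J(1))
    have "J = P" if ne: "J \<noteq> I"
    proof -
      obtain f where f: "f \<in> J" "f \<notin> I" using ne J by blast
      then obtain g where g: "g \<in> P" "f * g - 1 \<in> I" using A J by blast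
      have "g * f \<in> J" using f g by (intro J.ideal_mult)
      moreover have "f * g - 1 \<in> J" using g J by blast
      ultimately have "g * f - (f * g - 1) \<in> J" by (rule J.ideal_diff)
      then have "1 \<in> J" by (simp add: algebra_simps)
      then have "x \<in> J" if "x \<in> P" for x using J.ideal_mult[OF that] by force
      then show ?thesis using J by blast
    qed
    then show "J = I \<or> J = P" by blast
  qed
qed

lemma maximal_imp_prime_modulus:
  assumes max: "maximalideal I (mpoly_ring n)"
  shows "prime_modulus P I"
proof unfold_locales
  show "1 \<notin> I" using max maximal_iff by blast
  show "x \<in> I \<or> y \<in> I" if xy: "x \<in> P" "y \<in> P" "x * y \<in> I" for x y
  proof (rule ccontr)
    assume "\<not> (x \<in> I \<or> y \<in> I)"
    then obtain z where z: "z \<in> P" "x * z - 1 \<in> I" using max maximal_iff xy by blast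
    have "z * (x * y) - y * (x * z - 1) \<in> I"
      by (rule ideal_diff[OF ideal_mult[OF z(1) xy(3)] ideal_mult[OF xy(2) z(2)]])
    then have "y \<in> I" by (simp add: algebra_simps)
    with \<open>\<not> (x \<in> I \<or> y \<in> I)\<close> show False by blast
  qed
qed (use I_subset_P ideal_closed in auto)

end

section \<open>Minimal polynomials\<close>

lemma poly_ideal_principal:
  fixes J :: "'k::field poly set"
  assumes diff: "\<And>g h. g \<in> J \<Longrightarrow> h \<in> J \<Longrightarrow> g - h \<in> J"
    and mult: "\<And>g h. h \<in> J \<Longrightarrow> g * h \<in> J"
    and nonzero: "g0 \<in> J" "g0 \<noteq> 0"
  obtains m where "Polynomial.lead_coeff m = 1" "\<And>g. g \<in> J \<longleftrightarrow> m dvd g"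
proof -
  obtain h where h: "h \<in> J" "h \<noteq> 0"
    and least: "\<And>g. g \<in> J \<Longrightarrow> g \<noteq> 0 \<Longrightarrow> Polynomial.degree h \<le> Polynomial.degree g"
    using ex_has_least_nat[of "\<lambda>g. g \<in> J \<and> g \<noteq> 0" g0 Polynomial.degree] nonzero by blast
  define m where "m = Polynomial.smult (inverse (Polynomial.lead_coeff h)) h"
  have "m = [:inverse (Polynomial.lead_coeff h):] * h" by (simp add: m_def)
  then have mJ: "m \<in> J" using mult[OF h(1)] by (simp only:)
  have "Polynomial.lead_coeff m = 1" using h by (simp add: m_def)
  moreover have "g \<in> J \<longleftrightarrow> m dvd g" for g
  proof
    assume "g \<in> J"
    then have "g - (g div m) * m \<in> J" by (intro diff mult mJ)
    then have "g mod m \<in> J" by (simp add: minus_div_mult_eq_mod)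
    moreover have "g mod m = 0 \<or> Polynomial.degree (g mod m) < Polynomial.degree h"
      using degree_mod_less[of m g] h by (auto simp: m_def)
    ultimately have "g mod m = 0" using least by force
    then show "m dvd g" by (simp add: dvd_eq_mod_eq_0)
  next
    assume "m dvd g"
    then show "g \<in> J" using mult[OF mJ] by (auto elim!: dvdE simp: mult.commute)
  qed
  ultimately show thesis by (rule that)
qed

text \<open>
  The monic generator of the ideal \<open>(g, \<mu>)\<close> divides \<open>\<mu>\<close>, so it is a unit or an associate of \<open>\<mu>\<close>; in
  the second case \<open>\<mu>\<close> would divide \<open>g\<close>.
\<close>

lemma irreducible_bezout:
  fixes \<mu> :: "'k::field poly"
  assumes irr: "Factorial_Ring.irreducible \<mu>" and ndvd: "\<not> \<mu> dvd g"
  obtains a b where "a * g + b * \<mu> = 1"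
proof -
  define J where "J = {a * g + b * \<mu> | a b. True}"
  have nz: "\<mu> \<noteq> 0" using irr by auto
  have mem: "\<mu> \<in> J" "g \<in> J"
    unfolding J_def
    by (rule CollectI, rule exI[of _ 0], rule exI[of _ 1], simp,
        rule CollectI, rule exI[of _ 1], rule exI[of _ 0], simp)
  obtain m where m: "\<And>h. h \<in> J \<longleftrightarrow> m dvd h"
  proof (rule poly_ideal_principal[OF _ _ mem(1) nz])
    fix h h' assume "h \<in> J" "h' \<in> J"
    then obtain a b a' b' where "h = a * g + b * \<mu>" "h' = a' * g + b' * \<mu>" by (auto simp: J_def)
    then have "h - h' = (a - a') * g + (b - b') * \<mu>" by (simp add: algebra_simps)
    then show "h - h' \<in> J" unfolding J_def by blast
  next
    fix h h' assume "h' \<in> J"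
    then obtain a b where "h' = a * g + b * \<mu>" by (auto simp: J_def)
    then have "h * h' = (h * a) * g + (h * b) * \<mu>" by (simp add: algebra_simps)
    then show "h * h' \<in> J" unfolding J_def by blast
  qed blast
  then obtain c where c: "\<mu> = m * c" using mem by (auto elim: dvdE)
  have "\<not> c dvd 1"
  proof
    assume "c dvd 1"
    then have "\<mu> dvd m" using c by (metis dvd_mult_unit_iff dvd_refl mult.commute)
    then show False using m mem ndvd dvd_trans by blast
  qed
  then have "m dvd 1" using irreducibleD[OF irr c] by blast
  then have "1 \<in> J" using m by blast
  then show thesis using that by (auto simp: J_def)
qed

context mpoly_ideal
begin

lemma combine_powers:
  assumes f: "f \<in> P"
  shows "length cs \<le> m \<Longrightarrow>
    R.combine (map (\<lambda>c. cls (Const c)) cs) (map (\<lambda>i. cls (f ^ i)) [k..<k + m])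
      = cls (f ^ k * ev f (Poly cs))"
proof (induction cs arbitrary: k m)
  case Nil
  then show ?case by (simp add: cls_zero)
next
  case (Cons c cs)
  then obtain m' where m: "m = Suc m'" by (cases m) auto
  have "[k..<k + m] = k # [Suc k..<Suc k + m']"
    using m by (simp add: upt_conv_Cons)
  then show ?case
    using Cons.IH[of m' "Suc k"] Cons.prems m f
    by (simp add: cls_mult cls_add Const_mem ev_mem P.closed algebra_simps)
qed

text \<open>
  A linear relation between the powers of \<open>f\<close> is a polynomial in the kernel of \<open>ev f\<close> modulo \<open>I\<close>.
\<close>

lemma independent_powers:
  assumes proper: "1 \<notin> I" and f: "f \<in> P"
    and ker: "\<And>g. g \<noteq> 0 \<Longrightarrow> Polynomial.degree g < m \<Longrightarrow> ev f g \<notin> I"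
  shows "R.independent K (map (\<lambda>i. cls (f ^ i)) [0..<m])" (is "R.independent K ?Us")
proof (rule R.trivial_combine_imp_independent[OF K_subfield[OF proper]])
  show "set ?Us \<subseteq> carrier R" using f by (auto simp: P.power_mem)
  fix Ks assume Ks: "set Ks \<subseteq> K" "R.combine Ks ?Us = \<zero>\<^bsub>R\<^esub>"
  define Ks' where "Ks' = take m Ks"
  have "\<exists>cs. Ks' = map (\<lambda>c. cls (Const c)) cs"
    unfolding ex_map_conv using Ks(1) set_take_subset[of m Ks] by (auto simp: Ks'_def scalars_def)
  then obtain cs where cs: "Ks' = map (\<lambda>c. cls (Const c)) cs" by blast
  have len: "length cs \<le> m" using cs by (metis Ks'_def length_map length_take min.cobounded2)
  have "\<zero>\<^bsub>R\<^esub> = R.combine Ks' ?Us"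
    using Ks(2) R.combine_take[of ?Us Ks] by (simp add: Ks'_def)
  also have "\<dots> = cls (f ^ 0 * ev f (Poly cs))"
    using combine_powers[OF f len, of 0] by (simp add: cs)
  finally have "cls (ev f (Poly cs)) = \<zero>\<^bsub>R\<^esub>" by simp
  then have "ev f (Poly cs) \<in> I"
    using cls_eq_zero[OF ev_mem[OF f]] by blast
  moreover have "Polynomial.degree (Poly cs) < m" if "Poly cs \<noteq> 0"
  proof -
    have "nth_default 0 cs (Polynomial.degree (Poly cs)) \<noteq> 0"
      using that leading_coeff_0_iff[of "Poly cs"] by simp
    then show ?thesis using len by (auto simp: nth_default_def split: if_splits)
  qed
  ultimately have "Poly cs = 0" using ker by blast
  then obtain k where "cs = replicate k 0" by (auto simp: Poly_eq_0)
  then show "set (take (length ?Us) Ks) \<subseteq> {\<zero>\<^bsub>R\<^esub>}"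
    using cs by (auto simp: Ks'_def cls_zero)
qed

lemma dimension_carrier:
  assumes "zero_dimensional n I"
  shows "R.dimension (dimK n I (carrier R)) K (carrier R)"
  using assms R.finite_dimensionE[OF K_subfield] unfolding zero_dimensional_iff dimK_def over_def
  by blast

lemma relation_exists:
  assumes zd: "zero_dimensional n I" and f: "f \<in> P"
  obtains g where "g \<noteq> 0" "ev f g \<in> I"
proof (rule ccontr)
  assume "\<not> thesis"
  then have ker: "\<And>g. g \<noteq> 0 \<Longrightarrow> ev f g \<notin> I" using that by blast
  define m where "m = Suc (dimK n I (carrier R))"
  have proper: "1 \<notin> I" using zd by (simp add: zero_dimensional_iff)
  have "R.independent K (map (\<lambda>i. cls (f ^ i)) [0..<m])"
    using independent_powers[OF proper f] ker by blast
  then have "length (map (\<lambda>i. cls (f ^ i)) [0..<m]) \<le> dimK n I (carrier R)"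
    by (rule R.independent_length_le_dimension[OF K_subfield[OF proper] dimension_carrier[OF zd]])
      (use f in \<open>auto simp: P.power_mem\<close>)
  then show False by (simp add: m_def)
qed

lemma min_poly_spec:
  assumes zd: "zero_dimensional n I" and f: "f \<in> P"
  shows "Polynomial.lead_coeff (min_poly n I f) = 1" (is ?monic)
    and "ev f g \<in> I \<longleftrightarrow> min_poly n I f dvd g" (is ?ker)
proof -
  define J where "J = {g. ev f g \<in> I}"
  obtain g0 where "g0 \<in> J" "g0 \<noteq> 0" using relation_exists[OF zd f] by (auto simp: J_def)
  then obtain m where m: "Polynomial.lead_coeff m = 1" "\<And>g. g \<in> J \<longleftrightarrow> m dvd g"
    by (rule poly_ideal_principal[rotated 2])
      (auto simp: J_def intro: ideal_closed ev_mem[OF f])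
  have ker: "a_kernel ring_of_type_algebra R (residue_eval n I f) = J"
    using cls_eq_zero[OF ev_mem[OF f]]
    by (auto simp: a_kernel_def' J_def residue_eval_def ev_def ring_of_type_algebra_def)
  have PIdl: "PIdl\<^bsub>ring_of_type_algebra\<^esub> \<mu> = {g. \<mu> dvd g}" for \<mu> :: "'k poly"
    by (auto simp: cgenideal_def ring_of_type_algebra_def dvd_def mult.commute)
  have "min_poly n I f = m"
    unfolding min_poly_def ker PIdl
  proof (rule the_equality)
    show "Polynomial.lead_coeff m = 1 \<and> {g. m dvd g} = J" using m by blast
    fix \<mu> :: "'k poly" assume A: "Polynomial.lead_coeff \<mu> = 1 \<and> {g. \<mu> dvd g} = J"
    then have "\<mu> dvd m" "m dvd \<mu>" using m(2)[of m] m(2)[of \<mu>] by auto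
    then obtain c where c: "\<mu> = m * c" by (elim dvdE)
    have "m \<noteq> 0" "\<mu> \<noteq> 0" using A m(1) by auto
    then have "Polynomial.degree c = 0"
      using \<open>\<mu> dvd m\<close> dvd_imp_degree_le[of \<mu> m] c by (auto simp: degree_mult_eq)
    then obtain a where "c = [:a:]" by (rule degree_eq_zeroE)
    moreover have "Polynomial.lead_coeff c = 1"
      using A m(1) lead_coeff_mult[of m c] by (simp add: c)
    ultimately show "\<mu> = m" using c by simp
  qed
  then show ?monic ?ker using m by (auto simp: J_def)
qed

lemma min_poly_not_unit:
  assumes zd: "zero_dimensional n I" and f: "f \<in> P"
  shows "\<not> min_poly n I f dvd 1"
  using min_poly_spec(2)[OF assms, of 1] zd by (simp add: zero_dimensional_iff)

lemma min_poly_irreducible_iff: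
  assumes zd: "zero_dimensional n I" and f: "f \<in> P"
  shows "Factorial_Ring.irreducible (min_poly n I f) \<longleftrightarrow> \<not> reducible (min_poly n I f)"
  using min_poly_not_unit[OF assms] min_poly_spec(1)[OF assms] by (auto simp: reducible_def)

text \<open>
  The kernel of \<open>K[z] \<rightarrow> P/I\<close> is a prime ideal because \<open>P/I\<close> is a domain.
\<close>

lemma maximal_imp_not_reducible:
  assumes max: "maximalideal I (mpoly_ring n)" and zd: "zero_dimensional n I" and f: "f \<in> P"
  shows "\<not> reducible (min_poly n I f)"
proof -
  interpret Z: prime_modulus P I by (rule maximal_imp_prime_modulus[OF max])
  note spec = min_poly_spec[OF zd f]
  have nz: "min_poly n I f \<noteq> 0" using spec(1) by auto
  have unit: "b dvd 1" if ab: "min_poly n I f = a * b" and dvd: "min_poly n I f dvd a" for a b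
  proof -
    have "a * b dvd a * 1" using ab dvd by simp
    then show ?thesis using nz ab by (subst (asm) dvd_mult_cancel_left) auto
  qed
  have "Factorial_Ring.irreducible (min_poly n I f)"
  proof (rule Factorial_Ring.irreducibleI[OF nz min_poly_not_unit[OF zd f]])
    fix a b assume ab: "min_poly n I f = a * b"
    then have "ev f a * ev f b \<in> I" using spec(2)[of "a * b"] by simp
    then have "ev f a \<in> I \<or> ev f b \<in> I" using Z.prime ev_mem[OF f] by blast
    then show "a dvd 1 \<or> b dvd 1"
      using unit[of a b] unit[of b a] ab spec(2) by (auto simp: mult.commute)
  qed
  then show ?thesis using min_poly_irreducible_iff[OF zd f] by blast
qed

lemma inverse_from_irreducible:
  assumes zd: "zero_dimensional n I" and f: "f \<in> P"
    and irr: "Factorial_Ring.irreducible (min_poly n I f)" and g: "ev f g \<notin> I"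
  obtains a where "ev f a * ev f g - 1 \<in> I"
proof -
  have "\<not> min_poly n I f dvd g" using g min_poly_spec(2)[OF zd f] by blast
  then obtain a b where "a * g + b * min_poly n I f = 1" by (rule irreducible_bezout[OF irr])
  then have "a * g - 1 = (- b) * min_poly n I f" by (simp add: algebra_simps)
  then have "ev f (a * g - 1) \<in> I" using min_poly_spec(2)[OF zd f] by (metis dvd_triv_right)
  then show thesis by (intro that) simp
qed

text \<open>
  Below the degree of the minimal polynomial the powers of \<open>f\<close> are independent. There are as many
  of them as the dimension, so they span \<open>P/I\<close>: every residue class is a polynomial in \<open>f\<close>, and
  non-zero polynomials in \<open>f\<close> are invertible.
\<close>

lemma full_degree_imp_maximal:
  assumes zd: "zero_dimensional n I" and f: "f \<in> P"
    and nred: "\<not> reducible (min_poly n I f)"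
    and deg: "Polynomial.degree (min_poly n I f) = dimK n I (carrier R)"
  shows "maximalideal I (mpoly_ring n)"
  unfolding maximal_iff
proof (intro conjI ballI impI)
  show proper: "1 \<notin> I" using zd by (simp add: zero_dimensional_iff)
  have irr: "Factorial_Ring.irreducible (min_poly n I f)"
    using nred min_poly_irreducible_iff[OF zd f] by blast
  fix h assume h: "h \<in> P" "h \<notin> I"
  define d where "d = dimK n I (carrier R)"
  let ?Us = "map (\<lambda>i. cls (f ^ i)) [0..<d]"
  have Us: "set ?Us \<subseteq> carrier R" using f by (auto simp: P.power_mem)
  have "R.independent K ?Us"
  proof (rule independent_powers[OF proper f])
    fix g :: "'k poly" assume g: "g \<noteq> 0" "Polynomial.degree g < d"
    show "ev f g \<notin> I"
      using min_poly_spec(2)[OF zd f, of g] dvd_imp_degree_le[of "min_poly n I f" g] g deg d_def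
      by auto
  qed
  then have "R.Span K ?Us = carrier R"
    using R.independent_length_eq_dimension[OF K_subfield[OF proper] dimension_carrier[OF zd] _ Us]
    by (simp add: d_def)
  then have "cls h \<in> R.Span K ?Us" using h by simp
  then obtain Ks where Ks: "length Ks = length ?Us" "set Ks \<subseteq> K" "cls h = R.combine Ks ?Us"
    unfolding R.Span_eq_combine_set_length_version[OF K_subfield[OF proper] Us] by blast
  have "\<exists>cs. Ks = map (\<lambda>c. cls (Const c)) cs"
    unfolding ex_map_conv using Ks(2) by (auto simp: scalars_def)
  then obtain cs where cs: "Ks = map (\<lambda>c. cls (Const c)) cs" by blast
  have "cls h = cls (ev f (Poly cs))"
    using combine_powers[OF f, of cs d 0] Ks cs by simp
  then have diff: "h - ev f (Poly cs) \<in> I"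
    using cls_eq_iff[OF h(1) ev_mem[OF f]] by blast
  then have "ev f (Poly cs) \<notin> I" using h ideal_add[OF diff] by force
  then obtain a where a: "ev f a * ev f (Poly cs) - 1 \<in> I"
    by (rule inverse_from_irreducible[OF zd f irr])
  have "ev f a * (h - ev f (Poly cs)) + (ev f a * ev f (Poly cs) - 1) \<in> I"
    by (intro ideal_add[OF ideal_mult[OF ev_mem[OF f] diff] a])
  then have "h * ev f a - 1 \<in> I" by (simp add: algebra_simps)
  then show "\<exists>g\<in>P. h * g - 1 \<in> I" using ev_mem[OF f] by blast
qed

end

section \<open>Maximal ideals are zero-dimensional\<close>

context mpoly_ideal
begin

text \<open>
  \<open>P/I\<close> is a field, hence a G-domain with \<open>r = 1\<close>. Adjoining \<open>x\<^sub>i\<close> first puts it directly above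
  the constants.
\<close>

lemma maximal_imp_Var_algebraic:
  assumes max: "maximalideal I (mpoly_ring n)" and i: "i \<in> {1..n}"
  obtains g where "g \<noteq> 0" "ev (Var i) g \<in> I"
proof -
  interpret Z: prime_modulus P I by (rule maximal_imp_prime_modulus[OF max])
  let ?K = "range (Const :: 'k \<Rightarrow> 'k mpoly)"
  define us :: "'k mpoly list" where "us = map Var (sorted_list_of_set ({1..n} - {i}))"
  have us: "set (Var i # us) = Var ` {1..n}" using i by (auto simp: us_def)
  have K_P: "?K \<subseteq> P" by (auto intro: Const_mem)
  have us_P: "set (Var i # us) \<subseteq> P" unfolding us by (auto intro: Var_mem)
  note L = Const_range_subring[where 'k = 'k]
  have "P \<subseteq> adjoin_list ?K (Var i # us)"
  proof (rule carrier_generated[OF adjoin_list_subring[OF L]])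
    show "?K \<subseteq> adjoin_list ?K (Var i # us)" using subset_adjoin_list[OF L] by blast
    show "Var j \<in> adjoin_list ?K (Var i # us)" if "j \<in> {1..n}" for j
      using subset_adjoin_list[OF L, of "Var i # us"] us that by blast
  qed
  moreover have "adjoin_list ?K (Var i # us) \<subseteq> P"
    by (rule adjoin_list_subset[OF L _ carrier_subring]) (use K_P us_P in blast)
  ultimately have gen: "adjoin_list ?K (Var i # us) = P" by blast
  have "\<exists>g\<in>P. \<exists>k. f * g - 1 ^ k \<in> I" if "f \<in> P" "f \<notin> I" for f
    using max that unfolding maximal_iff by simp
  then have "Z.G_domain_mod P"
    unfolding Z.G_domain_mod_def using P.one_mem Z.one_notin_I by blast
  then have "Z.algebraic_mod ?K (Var i)"
    using Z.first_generator_algebraic[OF L K_P us_P] by (simp add: gen)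
  then obtain p where p: "p \<in> polys_over ?K" "p \<notin> polys_over I" "poly p (Var i) \<in> I"
    by (auto simp: Z.algebraic_mod_def)
  define g where "g = map_poly (\<lambda>x :: 'k mpoly. Poly_Mapping.lookup x 0) p"
  have "map_poly Const g = p"
  proof (rule poly_eqI)
    fix j
    obtain c where "Polynomial.coeff p j = Const c" using polys_over_coeff[OF p(1)] by blast
    then show "Polynomial.coeff (map_poly Const g) j = Polynomial.coeff p j"
      by (simp add: g_def coeff_map_poly) (simp add: Const_def)
  qed
  moreover from this have "g \<noteq> 0" using p Z.polys_I_0 by auto
  ultimately show thesis using p(3) by (intro that[of g]) (simp_all add: ev_def)
qed

text \<open>
  Translates a relation from polynomials over the type \<open>'k\<close> to the list polynomials over a subfield
  that the theory of algebraic elements uses; those have their leading coefficient at the head.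
\<close>

lemma algebraic_list:
  assumes proper: "1 \<notin> I" and f: "f \<in> P"
  shows "g \<noteq> 0 \<Longrightarrow> \<exists>p. p \<noteq> [] \<and> polynomial\<^bsub>R\<^esub> K p \<and> R.eval p (cls f) = cls (ev f g)"
proof (induction g)
  case (pCons c g)
  show ?case
  proof (cases "g = 0")
    case True
    then have "c \<noteq> 0" using pCons by simp
    have "cls (Const c) \<noteq> \<zero>\<^bsub>R\<^esub>"
    proof
      assume "cls (Const c) = \<zero>\<^bsub>R\<^esub>"
      then have "Const c \<in> I" using cls_eq_zero[OF Const_mem] by blast
      then have "Const (inverse c) * Const c \<in> I" by (intro ideal_mult Const_mem)
      then have "Const (inverse c * c) \<in> I" by (simp only: Const_hom)
      then show False using \<open>c \<noteq> 0\<close> proper by simp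
    qed
    then have "polynomial\<^bsub>R\<^esub> K [cls (Const c)]"
      by (auto simp: polynomial_def K_iff)
    moreover have "R.eval [cls (Const c)] (cls f) = cls (ev f (pCons c g))"
      using f True by (simp add: Const_mem)
    ultimately show ?thesis by blast
  next
    case False
    then obtain p where p: "p \<noteq> []" "polynomial\<^bsub>R\<^esub> K p" "R.eval p (cls f) = cls (ev f g)"
      using pCons.IH by blast
    have "polynomial\<^bsub>R\<^esub> K (p @ [cls (Const c)])"
      using p by (auto simp: polynomial_def K_iff)
    moreover have "set p \<subseteq> carrier R"
      using p K_subset by (auto simp: polynomial_def)
    then have "R.eval (p @ [cls (Const c)]) (cls f) = cls (ev f (pCons c g))"
      using f p by (simp add: R.eval_append_aux Const_mem cls_mult cls_add ev_mem P.closed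
          algebra_simps)
    ultimately show ?thesis by blast
  qed
qed simp

lemma maximal_imp_zero_dimensional:
  assumes max: "maximalideal I (mpoly_ring n)"
  shows "zero_dimensional n I"
proof -
  interpret F: field R by (rule maximalideal.quotient_is_field[OF max cring_mpoly_ring])
  have proper: "1 \<notin> I" using max maximal_iff by blast
  note K = K_subfield[OF proper]
  define xs where "xs = map (\<lambda>i. cls (Var i)) [1..<Suc n]"
  have xs: "set xs = (\<lambda>i. cls (Var i)) ` {1..n}"
    by (simp add: xs_def atLeastLessThanSuc_atLeastAtMost del: upt_Suc)
  have xs_R: "set xs \<subseteq> carrier R" unfolding xs by (auto intro!: cls_mem Var_mem)
  have "(R.algebraic over K) x" if x: "x \<in> set xs" for x
  proof -
    obtain i where i: "i \<in> {1..n}" "x = cls (Var i)" using x unfolding xs by blast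
    obtain g where g: "g \<noteq> 0" "ev (Var i) g \<in> I" by (rule maximal_imp_Var_algebraic[OF max i(1)])
    from algebraic_list[OF proper Var_mem[OF i(1)] \<open>g \<noteq> 0\<close>]
    obtain p where p: "p \<noteq> []" "polynomial\<^bsub>R\<^esub> K p"
      "R.eval p (cls (Var i)) = cls (ev (Var i) g)"
      by (elim exE conjE)
    have "cls (ev (Var i) g) = \<zero>\<^bsub>R\<^esub>"
      using cls_eq_zero[OF ev_mem[OF Var_mem[OF i(1)]]] g(2) by (rule iffD2)
    then have "R.eval p x = \<zero>\<^bsub>R\<^esub>"
      using p(3) i(2) by (simp only:)
    moreover have "p \<in> carrier (univ_poly R K)" using p(2) by (simp only: univ_poly_carrier)
    moreover note p(1)
    ultimately show ?thesis by (rule R.algebraicI[rotated 2])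
  qed
  then have fin: "R.finite_dimension K (R.finite_extension K xs)"
    by (rule F.finite_extension_finite_dimension(1)[OF K xs_R])
  let ?E = "R.finite_extension K xs"
  have E: "subring ?E R" by (rule F.finite_extension_is_subring[OF subfieldE(1)[OF K] xs_R])
  have E_R: "?E \<subseteq> carrier R" using subringE(1)[OF E] .
  have "P \<subseteq> {f \<in> P. cls f \<in> ?E}"
  proof (rule carrier_generated)
    show "unital_subring {f \<in> P. cls f \<in> ?E}"
    proof
      show "1 \<in> {f \<in> P. cls f \<in> ?E}" using subringE(3)[OF E] P.one_mem by (simp add: cls_one)
    next
      fix x y assume xy: "x \<in> {f \<in> P. cls f \<in> ?E}" "y \<in> {f \<in> P. cls f \<in> ?E}"
      have "cls x \<ominus>\<^bsub>R\<^esub> cls y \<in> ?E" "cls x \<otimes>\<^bsub>R\<^esub> cls y \<in> ?E"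
        using xy subringE(5-7)[OF E] by (auto simp: a_minus_def)
      then show "x - y \<in> {f \<in> P. cls f \<in> ?E}" "x * y \<in> {f \<in> P. cls f \<in> ?E}"
        using xy by (auto simp: cls_minus cls_mult P.closed)
    qed
    show "range Const \<subseteq> {f \<in> P. cls f \<in> ?E}"
    proof
      fix p :: "'k mpoly" assume "p \<in> range Const"
      then obtain c where "p = Const c" by blast
      moreover have "cls (Const c) \<in> K" unfolding K_iff by blast
      ultimately show "p \<in> {f \<in> P. cls f \<in> ?E}"
        using subsetD[OF R.finite_extension_incl[OF K_subset xs_R], of "cls (Const c)"] Const_mem
        by blast
    qed
    show "Var i \<in> {f \<in> P. cls f \<in> ?E}" if "i \<in> {1..n}" for i
      using F.finite_extension_mem[OF subfieldE(1)[OF K] xs_R] that xs by (auto simp: Var_mem)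
  qed
  then have "?E = carrier R" using E_R by (auto simp: carrier_R)
  with fin proper show ?thesis by (simp add: zero_dimensional_iff)
qed

end

section \<open>The Frobenius space over a finite field\<close>

lemma finite_field_card_gt_1:
  assumes "finite (UNIV :: 'k::field set)"
  shows "card (UNIV :: 'k set) > 1"
proof -
  have "card {0, 1 :: 'k} \<le> card (UNIV :: 'k set)" by (rule card_mono[OF assms]) simp
  then show ?thesis by simp
qed

lemma finite_field_power_card:
  fixes x :: "'k::field"
  assumes "finite (UNIV :: 'k set)"
  shows "x ^ card (UNIV :: 'k set) = x"
proof (cases "x = 0")
  case True
  then show ?thesis using finite_field_card_gt_1[OF assms] by (simp add: zero_power)
next
  case False
  let ?U = "UNIV - {0 :: 'k}"
  have "(\<Prod>y\<in>?U. x * y) = (\<Prod>y\<in>?U. y)"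
  proof (rule prod.reindex_bij_betw)
    show "bij_betw (\<lambda>y. x * y) ?U ?U"
    proof (rule bij_betw_byWitness[where f' = "\<lambda>y. y / x"])
      show "\<forall>y\<in>?U. x * y / x = y" "\<forall>y\<in>?U. x * (y / x) = y" using False by simp_all
      show "(\<lambda>y. x * y) ` ?U \<subseteq> ?U" "(\<lambda>y. y / x) ` ?U \<subseteq> ?U"
        using False by (simp_all add: image_subset_iff)
    qed
  qed
  then have "x ^ card ?U * (\<Prod>y\<in>?U. y) = 1 * (\<Prod>y\<in>?U. y)"
    unfolding prod.distrib prod_constant by (rule trans) (rule mult_1_left[symmetric])
  moreover have "(\<Prod>y\<in>?U. y) \<noteq> 0" by (subst prod_zero_iff) (use assms in auto)
  ultimately have "x ^ card ?U = 1" by (subst (asm) mult_right_cancel)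
  moreover have "card (UNIV :: 'k set) = Suc (card ?U)"
    by (rule card.remove[OF assms]) simp
  ultimately show ?thesis by (simp only: power_Suc mult_1_right)
qed

lemma prod_linear_factors:
  assumes fin: "finite (UNIV :: 'k::field set)"
  shows "[:0, 1:] ^ card (UNIV :: 'k set) - [:0, 1:] = (\<Prod>c\<in>UNIV. [:- c, 1 :: 'k:])"
    (is "?l = ?r")
proof (rule poly_eqI_degree_lead_coeff[where n = "card (UNIV :: 'k set)" and A = UNIV])
  let ?q = "card (UNIV :: 'k set)"
  have q: "?q > 1" by (rule finite_field_card_gt_1[OF fin])
  have deg: "Polynomial.degree ?r = ?q"
    by (subst degree_prod_eq_sum_degree) auto
  show "Polynomial.degree ?r \<le> ?q" by (simp add: deg)
  have "Polynomial.coeff ?r ?q = Polynomial.lead_coeff ?r" by (simp add: deg)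
  also have "\<dots> = 1" by (simp add: lead_coeff_prod)
  finally show "Polynomial.coeff ?l ?q = Polynomial.coeff ?r ?q"
    using q coeff_linear_power[of "0::'k" ?q] by (simp add: coeff_pCons split: nat.split)
  show "Polynomial.degree ?l \<le> ?q"
    using q degree_power_le[of "[:0, 1 :: 'k:]" ?q] by (intro degree_diff_le) auto
  show "poly ?l z = poly ?r z" for z
    using finite_field_power_card[OF fin, of z] fin
    by (auto simp: poly_prod poly_power prod_zero_iff intro: exI[of _ z])
qed simp

text \<open>
  \<open>(X + 1)\<^sup>q\<close> and \<open>X\<^sup>q + 1\<close> are monic of degree \<open>q\<close> and agree on all \<open>q\<close> elements of the field, so
  they are equal. This gives additivity of the \<open>q\<close>-th power map without writing \<open>q\<close> as a power of
  the characteristic.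
\<close>

lemma finite_field_choose_eq_0:
  assumes fin: "finite (UNIV :: 'k::field set)" and i: "0 < i" "i < card (UNIV :: 'k set)"
  shows "of_nat (card (UNIV :: 'k set) choose i) = (0 :: 'k)"
proof -
  let ?q = "card (UNIV :: 'k set)"
  have "[:1, 1 :: 'k:] ^ ?q = [:0, 1:] ^ ?q + 1"
  proof (rule poly_eqI_degree_lead_coeff[where n = ?q and A = UNIV])
    show "Polynomial.coeff ([:1, 1 :: 'k:] ^ ?q) ?q = Polynomial.coeff ([:0, 1:] ^ ?q + 1) ?q"
      using i coeff_linear_power[of "0::'k" ?q] coeff_linear_power[of "1::'k" ?q] by simp
    show "Polynomial.degree ([:1, 1 :: 'k:] ^ ?q) \<le> ?q"
      using degree_power_le[of "[:1, 1 :: 'k:]" ?q] by simp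
    show "Polynomial.degree ([:0, 1 :: 'k:] ^ ?q + 1) \<le> ?q"
      using degree_power_le[of "[:0, 1 :: 'k:]" ?q] by (intro degree_add_le) auto
    show "poly ([:1, 1:] ^ ?q) z = poly ([:0, 1:] ^ ?q + 1) z" for z :: 'k
      using finite_field_power_card[OF fin] by (simp add: poly_power)
  qed simp
  then have "Polynomial.coeff ([:1, 1 :: 'k:] ^ ?q) i = Polynomial.coeff ([:0, 1:] ^ ?q + 1) i"
    by simp
  then show ?thesis using i by (simp add: coeff_linear_poly_power zero_power)
qed

lemma Const_of_nat: "Const (of_nat m) = of_nat m"
  by (induction m) auto

lemma frobenius_diff:
  fixes a b :: "'k::field mpoly"
  assumes fin: "finite (UNIV :: 'k set)"
  defines "q \<equiv> card (UNIV :: 'k set)"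
  shows "(a - b) ^ q = a ^ q - b ^ q"
proof -
  have add: "(x + y) ^ q = x ^ q + y ^ q" for x y :: "'k mpoly"
  proof -
    have q: "q > 1" using finite_field_card_gt_1[OF fin] by (simp add: q_def)
    have zero: "of_nat (q choose i) = (0 :: 'k mpoly)" if "i \<in> {..q} - {0, q}" for i
      using finite_field_choose_eq_0[OF fin, of i] that
      by (subst Const_of_nat[symmetric]) (auto simp: q_def)
    have "(x + y) ^ q = (\<Sum>i\<le>q. of_nat (q choose i) * x ^ i * y ^ (q - i))"
      by (rule binomial_ring)
    also have "\<dots> = (\<Sum>i\<in>{0, q}. of_nat (q choose i) * x ^ i * y ^ (q - i))"
      using zero by (intro sum.mono_neutral_right) auto
    finally show ?thesis using q by simp
  qed
  show ?thesis using add[of "a - b" b] by simp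
qed

context mpoly_ideal
begin

lemma carrier_finite:
  assumes zd: "zero_dimensional n I" and fin: "finite (UNIV :: 'k set)"
  shows "finite (carrier R)"
proof -
  have K: "subfield K R" using K_subfield zd by (simp add: zero_dimensional_iff)
  obtain Us where Us: "set Us \<subseteq> carrier R" "R.Span K Us = carrier R"
    using R.exists_base[OF K dimension_carrier[OF zd]] by blast
  have "finite K" using fin by (simp add: scalars_def)
  then have "finite {Ks. set Ks \<subseteq> K \<and> length Ks = length Us}" by (rule finite_lists_length_eq)
  moreover have "carrier R \<subseteq> (\<lambda>Ks. R.combine Ks Us) ` {Ks. set Ks \<subseteq> K \<and> length Ks = length Us}"
    using R.Span_eq_combine_set_length_version[OF K Us(1)] Us(2) by blast
  ultimately show ?thesis by (blast intro: finite_surj)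
qed

lemma frob_space_eq: "frob_space q R = cls ` {f \<in> P. f ^ q - f \<in> I}"
proof -
  have "cls f [^]\<^bsub>R\<^esub> q \<ominus>\<^bsub>R\<^esub> cls f = \<zero>\<^bsub>R\<^esub> \<longleftrightarrow> f ^ q - f \<in> I" if f: "f \<in> P" for f
    using cls_eq_zero[OF P.diff_mem[OF P.power_mem[OF f] f]] f
    by (simp add: cls_power cls_minus P.power_mem)
  then show ?thesis by (auto simp: frob_space_def carrier_R)
qed

lemma scalars_in_frob_space:
  assumes fin: "finite (UNIV :: 'k set)"
  shows "K \<subseteq> frob_space (card (UNIV :: 'k set)) R"
proof -
  have "Const c ^ card (UNIV :: 'k set) - Const c \<in> I" for c :: 'k
    using finite_field_power_card[OF fin, of c] ideal_0 by (simp flip: Const_power)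
  then show ?thesis by (auto simp: frob_space_eq scalars_def Const_mem)
qed

text \<open>
  Substituting \<open>f\<close> in the factorisation of \<open>X\<^sup>q - X\<close> and using that \<open>I\<close> is prime shows that an
  element of the Frobenius space is congruent to one of the constants.
\<close>

lemma maximal_imp_frob_dim_1:
  assumes max: "maximalideal I (mpoly_ring n)" and fin: "finite (UNIV :: 'k set)"
  shows "dimK n I (frob_space (card (UNIV :: 'k set)) R) = 1"
proof -
  interpret Z: prime_modulus P I by (rule maximal_imp_prime_modulus[OF max])
  let ?q = "card (UNIV :: 'k set)"
  have "cls f \<in> K" if f: "f \<in> P" "f ^ ?q - f \<in> I" for f
  proof -
    have prod: "\<exists>c\<in>T. f - Const c \<in> I" if "finite T" "(\<Prod>c\<in>T. f - Const c) \<in> I" for T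
      using that
    proof (induction T)
      case empty
      then show ?case using Z.one_notin_I by simp
    next
      case (insert c T)
      have "(\<Prod>c\<in>S. f - Const c) \<in> P" for S
        by (induction S rule: infinite_finite_induct) (auto intro!: P.closed f Const_mem)
      then show ?case
        using insert Z.prime[of "f - Const c" "\<Prod>c\<in>T. f - Const c"] f
        by (auto simp: P.closed Const_mem)
    qed
    have "f ^ ?q - f = ev f ([:0, 1:] ^ ?q - [:0, 1:])" by simp
    also have "\<dots> = (\<Prod>c\<in>UNIV. f - Const c)"
      unfolding prod_linear_factors[OF fin] by (simp add: ev_prod)
    finally obtain c where "f - Const c \<in> I" using prod[OF fin] f by auto
    then show ?thesis using cls_eq_iff[OF f(1) Const_mem] by (auto simp: K_iff)
  qed
  then have "frob_space ?q R = K"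
    using scalars_in_frob_space[OF fin] by (auto simp: frob_space_eq)
  then show ?thesis
    using R.dimI[OF K_subfield R.dimension_one[OF K_subfield]] Z.one_notin_I
    by (simp add: dimK_def over_def)
qed

text \<open>
  The Frobenius space is a subspace that contains \<open>K\<close>; both have dimension one and are spanned
  by \<open>1\<close>.
\<close>

lemma frob_dim_1_imp_scalars:
  assumes zd: "zero_dimensional n I" and fin: "finite (UNIV :: 'k set)"
    and dim: "dimK n I (frob_space (card (UNIV :: 'k set)) R) = 1"
  shows "frob_space (card (UNIV :: 'k set)) R = K"
proof -
  let ?q = "card (UNIV :: 'k set)"
  let ?F = "frob_space ?q R"
  have proper: "1 \<notin> I" using zd by (simp add: zero_dimensional_iff)
  note K = K_subfield[OF proper]
  have diff: "x \<ominus>\<^bsub>R\<^esub> y \<in> ?F" if xy: "x \<in> ?F" "y \<in> ?F" for x y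
  proof -
    obtain f g where fg: "f \<in> P" "g \<in> P" "f ^ ?q - f \<in> I" "g ^ ?q - g \<in> I"
      "x = cls f" "y = cls g" using xy by (auto simp: frob_space_eq)
    have "(f - g) ^ ?q - (f - g) = (f ^ ?q - f) - (g ^ ?q - g)"
      by (simp add: frobenius_diff[OF fin])
    also have "\<dots> \<in> I" by (rule ideal_diff[OF fg(3,4)])
    finally show ?thesis using fg by (auto simp: frob_space_eq cls_minus P.closed)
  qed
  have F_R: "?F \<subseteq> carrier R" by (auto simp: frob_space_def)
  have zero: "\<zero>\<^bsub>R\<^esub> \<in> ?F"
    using scalars_in_frob_space[OF fin] subringE(2)[OF subfieldE(1)[OF K]] by blast
  have uminus: "\<ominus>\<^bsub>R\<^esub> x \<in> ?F" if "x \<in> ?F" for x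
    using diff[OF zero that] F_R that by (auto simp: a_minus_def)
  have "subalgebra K ?F R"
  proof (rule subalgebra.intro)
    show "subgroup ?F (add_monoid R)"
    proof (rule R.add.subgroupI[OF F_R])
      show "?F \<noteq> {}" using zero by blast
      show "\<ominus>\<^bsub>R\<^esub> x \<in> ?F" if "x \<in> ?F" for x
        by (rule uminus[OF that])
      show "x \<oplus>\<^bsub>R\<^esub> y \<in> ?F" if "x \<in> ?F" "y \<in> ?F" for x y
        using diff[OF that(1) uminus[OF that(2)]] F_R that by (auto simp: a_minus_def)
    qed
    show "subalgebra_axioms K ?F R"
    proof
      fix k v assume "k \<in> K" "v \<in> ?F"
      then obtain c f where cf: "k = cls (Const c)" "f \<in> P" "f ^ ?q - f \<in> I" "v = cls f"
        by (auto simp: frob_space_eq K_iff)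
      have "(Const c * f) ^ ?q - Const c * f = Const c * (f ^ ?q - f)"
        using finite_field_power_card[OF fin, of c]
        by (simp add: power_mult_distrib algebra_simps flip: Const_power)
      also have "\<dots> \<in> I" using cf by (intro ideal_mult Const_mem)
      finally show "k \<otimes>\<^bsub>R\<^esub> v \<in> ?F"
        using cf by (auto simp: frob_space_eq cls_mult Const_mem P.closed)
    qed
  qed
  then have "R.finite_dimension K ?F"
    using R.subalbegra_incl_imp_finite_dimension[OF K _ _ F_R] zd
    by (simp add: zero_dimensional_iff)
  then have "R.dimension 1 K ?F"
    using R.finite_dimensionE[OF K, of ?F] dim by (simp add: dimK_def over_def)
  moreover have "\<one>\<^bsub>R\<^esub> \<noteq> \<zero>\<^bsub>R\<^esub>" using proper cls_eq_zero[OF P.one_mem] by (simp add: cls_one)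
  then have ind: "R.independent K [\<one>\<^bsub>R\<^esub>]"
    by (intro R.li_Cons R.li_Nil R.one_closed) simp
  moreover have one: "\<one>\<^bsub>R\<^esub> \<in> K" using subringE(3)[OF subfieldE(1)[OF K]] .
  ultimately have "R.Span K [\<one>\<^bsub>R\<^esub>] = ?F"
    using R.independent_length_eq_dimension[OF K, of 1 ?F "[\<one>\<^bsub>R\<^esub>]"] scalars_in_frob_space[OF fin]
    by auto
  moreover have "R.Span K [\<one>\<^bsub>R\<^esub>] = K"
    using R.independent_length_eq_dimension[OF K R.dimension_one[OF K] ind] one by simp
  ultimately show ?thesis by simp
qed

text \<open>
  The image of the Frobenius map is a subalgebra, so it suffices to reach each \<open>x\<^sub>i\<close>. The residue
  classes of polynomials in \<open>x\<^sub>i\<close> form a finite field (the set \<open>A\<close> below); the Frobenius map sends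
  it into itself injectively, hence onto itself.
\<close>

lemma frobenius_surjective:
  assumes zd: "zero_dimensional n I" and fin: "finite (UNIV :: 'k set)"
    and irr: "\<And>i. i \<in> {1..n} \<Longrightarrow> \<not> reducible (min_poly n I (Var i))" and f: "f \<in> P"
  shows "\<exists>h\<in>P. f - h ^ card (UNIV :: 'k set) \<in> I"
proof -
  let ?q = "card (UNIV :: 'k set)"
  define T where "T = {f \<in> P. \<exists>h\<in>P. f - h ^ ?q \<in> I}"
  have "P \<subseteq> T"
  proof (rule carrier_generated)
    show "unital_subring T"
    proof
      show "1 \<in> T" unfolding T_def using ideal_0 P.one_mem by (auto intro!: bexI[of _ 1])
    next
      fix x y assume "x \<in> T" "y \<in> T"
      then obtain h k where hk: "x \<in> P" "y \<in> P" "h \<in> P" "k \<in> P" "x - h ^ ?q \<in> I" "y - k ^ ?q \<in> I"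
        by (auto simp: T_def)
      have "(x - y) - (h - k) ^ ?q = (x - h ^ ?q) - (y - k ^ ?q)"
        by (simp add: frobenius_diff[OF fin])
      also have "\<dots> \<in> I" by (rule ideal_diff[OF hk(5,6)])
      finally show "x - y \<in> T"
        unfolding T_def using hk(1-4) by (blast intro: P.diff_mem)
      have "x * y - (h * k) ^ ?q = y * (x - h ^ ?q) + h ^ ?q * (y - k ^ ?q)"
        by (simp add: algebra_simps power_mult_distrib)
      also have "\<dots> \<in> I" by (intro ideal_add ideal_mult hk P.closed)
      finally show "x * y \<in> T"
        unfolding T_def using hk(1-4) by (blast intro: P.mult_mem)
    qed
    have "Const c - Const c ^ ?q \<in> I" for c :: 'k
      using finite_field_power_card[OF fin, of c] ideal_0 by (simp flip: Const_power)
    then show "range Const \<subseteq> T" unfolding T_def using Const_mem by blast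
    fix i assume i: "i \<in> {1..n}"
    note x = Var_mem[OF i]
    have mu: "Factorial_Ring.irreducible (min_poly n I (Var i))"
      using irr[OF i] min_poly_irreducible_iff[OF zd x] by blast
    define A where "A = range (\<lambda>g. cls (ev (Var i) g))"
    define \<phi> where "\<phi> a = a [^]\<^bsub>R\<^esub> ?q" for a
    have \<phi>: "\<phi> (cls (ev (Var i) g)) = cls (ev (Var i) (g ^ ?q))" for g
      by (simp add: \<phi>_def cls_power ev_mem[OF x])
    have "finite A"
      by (rule finite_subset[OF _ carrier_finite[OF zd fin]]) (auto simp: A_def ev_mem[OF x])
    moreover have "\<phi> ` A \<subseteq> A"
    proof
      fix b assume "b \<in> \<phi> ` A"
      then obtain g where "b = \<phi> (cls (ev (Var i) g))" unfolding A_def by blast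
      then show "b \<in> A" unfolding A_def \<phi> by (rule range_eqI)
    qed
    moreover have "inj_on \<phi> A"
    proof (rule inj_onI)
      fix a b assume "a \<in> A" "b \<in> A" "\<phi> a = \<phi> b"
      then obtain g h where gh: "a = cls (ev (Var i) g)" "b = cls (ev (Var i) h)"
        "cls (ev (Var i) (g ^ ?q)) = cls (ev (Var i) (h ^ ?q))"
        unfolding A_def by (auto simp only: \<phi>)
      then have "ev (Var i) g ^ ?q - ev (Var i) h ^ ?q \<in> I"
        using cls_eq_iff[OF ev_mem[OF x, of "g ^ ?q"] ev_mem[OF x, of "h ^ ?q"]] by simp
      then have pow: "ev (Var i) (g - h) ^ ?q \<in> I" by (simp add: frobenius_diff[OF fin])
      have "ev (Var i) (g - h) \<in> I"
      proof (rule ccontr)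
        assume "ev (Var i) (g - h) \<notin> I"
        then obtain a where a: "ev (Var i) a * ev (Var i) (g - h) - 1 \<in> I"
          by (rule inverse_from_irreducible[OF zd x mu])
        have "(ev (Var i) a * ev (Var i) (g - h)) ^ ?q - 1 ^ ?q
            = (ev (Var i) a * ev (Var i) (g - h) - 1) ^ ?q"
          by (rule frobenius_diff[OF fin, symmetric])
        also have "\<dots> = (ev (Var i) a * ev (Var i) (g - h) - 1) ^ (?q - 1)
            * (ev (Var i) a * ev (Var i) (g - h) - 1)"
          using finite_field_card_gt_1[OF fin] by (simp flip: power_Suc2)
        also have "\<dots> \<in> I"
          by (intro ideal_mult a P.closed ev_mem[OF x])
        finally have 1: "ev (Var i) a ^ ?q * ev (Var i) (g - h) ^ ?q - 1 \<in> I"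
          by (simp add: power_mult_distrib)
        have "ev (Var i) a ^ ?q * ev (Var i) (g - h) ^ ?q \<in> I"
          by (intro ideal_mult pow P.closed ev_mem[OF x])
        from ideal_diff[OF this 1] have "1 \<in> I" by simp
        then show False using zd by (simp add: zero_dimensional_iff)
      qed
      then show "a = b" using gh(1,2) cls_eq_iff[OF ev_mem[OF x, of g] ev_mem[OF x, of h]] by simp
    qed
    ultimately have "\<phi> ` A = A" by (rule endo_inj_surj)
    moreover have "cls (Var i) \<in> A"
      unfolding A_def by (rule range_eqI[of _ _ "[:0, 1:]"]) simp
    ultimately have "cls (Var i) \<in> \<phi> ` A" by simp
    then obtain g where "cls (Var i) = \<phi> (cls (ev (Var i) g))" unfolding A_def by blast
    then have "cls (Var i) = cls (ev (Var i) (g ^ ?q))" by (simp only: \<phi>)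
    then have "Var i - ev (Var i) g ^ ?q \<in> I"
      using cls_eq_iff[OF x ev_mem[OF x, of "g ^ ?q"]] by simp
    then show "Var i \<in> T" unfolding T_def using x ev_mem[OF x] by blast
  qed
  then show ?thesis using f by (auto simp: T_def)
qed

text \<open>
  A surjective map of a finite set to itself is injective, and an injective Frobenius map
  has no nilpotents in its domain except \<open>0\<close>.
\<close>

lemma residue_ring_reduced:
  assumes zd: "zero_dimensional n I" and fin: "finite (UNIV :: 'k set)"
    and irr: "\<And>i. i \<in> {1..n} \<Longrightarrow> \<not> reducible (min_poly n I (Var i))"
    and f: "f \<in> P" and pow: "f ^ N \<in> I"
  shows "f \<in> I"
proof -
  let ?q = "card (UNIV :: 'k set)"
  have q: "?q > 1" by (rule finite_field_card_gt_1[OF fin])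
  define \<phi> where "\<phi> a = a [^]\<^bsub>R\<^esub> ?q" for a
  have "\<phi> ` carrier R = carrier R"
  proof
    show "carrier R \<subseteq> \<phi> ` carrier R"
    proof
      fix a assume "a \<in> carrier R"
      then obtain f where f: "f \<in> P" "a = cls f" by (auto simp: carrier_R)
      obtain h where h: "h \<in> P" "f - h ^ ?q \<in> I"
        using frobenius_surjective[OF zd fin irr f(1)] by blast
      then have "cls f = \<phi> (cls h)"
        using cls_eq_iff[OF f(1) P.power_mem[OF h(1)]] by (simp add: \<phi>_def cls_power)
      then show "a \<in> \<phi> ` carrier R" using f h by auto
    qed
  qed (auto simp: \<phi>_def)
  then have inj: "inj_on \<phi> (carrier R)"
    using carrier_finite[OF zd fin] by (simp add: eq_card_imp_inj_on)
  have one_step: "g \<in> I" if g: "g \<in> P" "g ^ ?q \<in> I" for g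
  proof -
    have "\<phi> (cls g) = \<phi> \<zero>\<^bsub>R\<^esub>"
      using g q cls_eq_zero[OF P.power_mem[OF g(1)]]
      by (simp add: \<phi>_def cls_power R.nat_pow_zero)
    then have "cls g = \<zero>\<^bsub>R\<^esub>" using inj_onD[OF inj] g by auto
    then show ?thesis using cls_eq_zero[OF g(1)] by blast
  qed
  have steps: "g \<in> I" if "g \<in> P" "g ^ (?q ^ j) \<in> I" for g j
    using that
  proof (induction j arbitrary: g)
    case (Suc j)
    then have "(g ^ (?q ^ j)) ^ ?q \<in> I" by (simp add: mult.commute flip: power_mult)
    then show ?case using Suc one_step[of "g ^ (?q ^ j)"] P.power_mem by blast
  qed simp
  have "N < ?q ^ N" using q by (intro power_gt_expt) simp
  then have "f ^ (?q ^ N) = f ^ (?q ^ N - N) * f ^ N" by (simp flip: power_add)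
  also have "\<dots> \<in> I" using pow f by (intro ideal_mult P.closed)
  finally show ?thesis using steps[OF f] by blast
qed

text \<open>
  By finiteness \<open>f\<^sup>i = f\<^sup>j\<close> in \<open>P/I\<close> for some \<open>j = i + p > i\<close>, so \<open>f (1 - f\<^sup>p)\<close> is nilpotent and
  therefore zero. Thus \<open>e = f\<^sup>p\<close> is idempotent, and \<open>e \<noteq> 0\<close> because \<open>f = f e\<close>. The Frobenius space
  contains \<open>e\<close> and consists of constants, which makes \<open>f\<close> invertible.
\<close>

lemma frob_dim_1_imp_maximal:
  assumes zd: "zero_dimensional n I" and fin: "finite (UNIV :: 'k set)"
    and irr: "\<And>i. i \<in> {1..n} \<Longrightarrow> \<not> reducible (min_poly n I (Var i))"
    and dim: "dimK n I (frob_space (card (UNIV :: 'k set)) R) = 1"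
  shows "maximalideal I (mpoly_ring n)"
  unfolding maximal_iff
proof (intro conjI ballI impI)
  show proper: "1 \<notin> I" using zd by (simp add: zero_dimensional_iff)
  note reduced = residue_ring_reduced[OF zd fin irr]
  fix f assume f: "f \<in> P" "f \<notin> I"
  let ?q = "card (UNIV :: 'k set)"
  have "\<not> inj (\<lambda>k::nat. cls (f ^ k))"
  proof
    assume "inj (\<lambda>k::nat. cls (f ^ k))"
    moreover have "range (\<lambda>k::nat. cls (f ^ k)) \<subseteq> carrier R" using f by (auto simp: P.power_mem)
    then have "finite (range (\<lambda>k::nat. cls (f ^ k)))"
      using carrier_finite[OF zd fin] finite_subset by blast
    ultimately show False using finite_imageD infinite_UNIV_nat by blast
  qed
  then obtain i' j' where "i' \<noteq> j'" "cls (f ^ i') = cls (f ^ j')"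
    unfolding inj_def by blast
  then obtain i j where ij: "i < j" "cls (f ^ i) = cls (f ^ j)"
    by (cases i' j' rule: linorder_cases) simp_all
  define p where "p = j - i"
  have p: "p > 0" "j = i + p" using ij by (auto simp: p_def)
  have "f ^ i - f ^ j \<in> I"
    using ij cls_eq_iff[OF P.power_mem[OF f(1)] P.power_mem[OF f(1)]] by blast
  then have "(1 - f ^ p) ^ i * (f * (f ^ i - f ^ j)) \<in> I"
    using f(1) by (intro ideal_mult P.closed)
  also have "(1 - f ^ p) ^ i * (f * (f ^ i - f ^ j)) = (f * (1 - f ^ p)) ^ Suc i"
  proof -
    have "f ^ i - f ^ j = f ^ i * (1 - f ^ p)" by (simp add: p(2) power_add right_diff_distrib)
    then show ?thesis by (simp only: power_Suc power_mult_distrib mult_ac)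
  qed
  finally have "f * (1 - f ^ p) \<in> I"
    using f by (intro reduced[of "f * (1 - f ^ p)" "Suc i"] P.closed)
  then have stable: "f - f ^ p * f \<in> I" by (simp add: algebra_simps)
  define e where "e = f ^ p"
  have eP: "e \<in> P" using f by (simp add: e_def P.power_mem)
  have "f ^ (p - 1) * (f - f ^ p * f) \<in> I" using f stable by (intro ideal_mult P.closed)
  also have "f ^ (p - 1) * (f - f ^ p * f) = e - e * e"
    using p(1) by (simp add: e_def algebra_simps flip: power_Suc2) (simp add: power_eq_if)
  finally have idem: "e - e * e \<in> I" .
  have "e ^ Suc k - e \<in> I" for k
  proof (induction k)
    case (Suc k)
    have "e * (e ^ Suc k - e) - (e - e * e) \<in> I"
      by (rule ideal_diff[OF ideal_mult[OF eP Suc] idem])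
    then show ?case by (simp add: algebra_simps)
  qed (simp add: ideal_0)
  from this[of "?q - 1"] have "e ^ ?q - e \<in> I"
    using finite_field_card_gt_1[OF fin] by simp
  then have "cls e \<in> K"
    using frob_dim_1_imp_scalars[OF zd fin dim] eP by (auto simp: frob_space_eq)
  then obtain c where "cls e = cls (Const c)" by (auto simp: K_iff)
  then have c: "e - Const c \<in> I" using cls_eq_iff[OF eP Const_mem] by blast
  have "c \<noteq> 0"
  proof
    assume "c = 0"
    then have "f * e \<in> I" using c f by (intro ideal_mult) simp_all
    from ideal_add[OF stable this] have "f \<in> I" by (simp add: e_def mult.commute)
    with f show False by blast
  qed
  define g where "g = Const (inverse c) * f ^ (p - 1)"
  have "f * g - 1 = Const (inverse c) * e - Const (inverse c * c)"
    using p(1) \<open>c \<noteq> 0\<close> by (simp add: g_def e_def power_eq_if algebra_simps del: Const_hom(5))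
  also have "\<dots> = Const (inverse c) * (e - Const c)" by (simp add: algebra_simps)
  also have "\<dots> \<in> I" by (intro ideal_mult c Const_mem)
  finally have "f * g - 1 \<in> I" .
  moreover have "g \<in> P" unfolding g_def using f by (intro P.closed Const_mem)
  ultimately show "\<exists>g\<in>P. f * g - 1 \<in> I" by blast
qed

end

section \<open>Runs of the procedure\<close>

definition first_loop :: "nat \<Rightarrow> 'k::field mpoly set \<Rightarrow> nat \<Rightarrow> nat \<Rightarrow> bool" where
  "first_loop n I d i \<longleftrightarrow> zero_dimensional n I \<and>
     d = dimK n I (carrier (residue_alg n I)) \<and> 1 \<le> i \<and>
     (\<forall>j\<in>{1..n}. j < i \<longrightarrow> \<not> reducible (min_poly n I (Var j)))"

definition second_loop :: "nat \<Rightarrow> 'k::field mpoly set \<Rightarrow> nat \<Rightarrow> bool" where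
  "second_loop n I d \<longleftrightarrow> zero_dimensional n I \<and>
     d = dimK n I (carrier (residue_alg n I)) \<and> infinite (UNIV :: 'k set)"

fun run_invariant :: "nat \<Rightarrow> 'k::field mpoly set \<Rightarrow> 'k poly state \<Rightarrow> bool" where
  "run_invariant n I Step1 \<longleftrightarrow> True"
| "run_invariant n I Step2 \<longleftrightarrow> zero_dimensional n I"
| "run_invariant n I (Step3_1 d i) \<longleftrightarrow> first_loop n I d i"
| "run_invariant n I (Step3_2 d i \<mu>) \<longleftrightarrow>
     first_loop n I d i \<and> i \<le> n \<and> \<mu> = min_poly n I (Var i)"
| "run_invariant n I (Step3_3 d i \<mu>) \<longleftrightarrow>
     first_loop n I d i \<and> i \<le> n \<and> \<mu> = min_poly n I (Var i) \<and> \<not> reducible \<mu>"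
| "run_invariant n I (Step4 d) \<longleftrightarrow> first_loop n I d (Suc n)"
| "run_invariant n I (Step5_1 d) \<longleftrightarrow> second_loop n I d"
| "run_invariant n I (Step5_2 d \<mu>) \<longleftrightarrow>
     second_loop n I d \<and> (\<exists>f \<in> carrier (mpoly_ring n). \<mu> = min_poly n I f)"
| "run_invariant n I (Step5_3 d \<mu>) \<longleftrightarrow>
     second_loop n I d \<and> (\<exists>f \<in> carrier (mpoly_ring n). \<mu> = min_poly n I f) \<and> \<not> reducible \<mu>"
| "run_invariant n I (Return b) \<longleftrightarrow> (b \<longleftrightarrow> maximalideal I (mpoly_ring n))"

lemma linear_forms_subset: "linear_forms n \<subseteq> carrier (mpoly_ring n)"
proof -
  interpret P: unital_subring "carrier (mpoly_ring n)" by (rule carrier_subring)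
  show ?thesis
    by (auto simp: linear_forms_def intro!: P.sum_mem P.mult_mem Const_mem Var_mem)
qed

context mpoly_ideal
begin

lemma run_invariant_step:
  assumes "proc_step n I s s'" "run_invariant n I s"
  shows "run_invariant n I s'"
  using assms
proof cases
  case s1_no
  then show ?thesis using maximal_imp_zero_dimensional by auto
next
  case s2
  then show ?thesis using assms(2) by (simp add: first_loop_def)
next
  case (s31_end i d)
  then show ?thesis using assms(2) by (simp add: first_loop_def)
next
  case (s32_red \<mu> d i)
  then show ?thesis
    using assms(2) maximal_imp_not_reducible[OF _ _ Var_mem[of i n]] by (auto simp: first_loop_def)
next
  case (s33_eq \<mu> d i)
  then show ?thesis
    using assms(2) full_degree_imp_maximal[OF _ Var_mem[of i n]] by (auto simp: first_loop_def)
next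
  case (s33 \<mu> d i)
  then show ?thesis using assms(2) by (auto simp: first_loop_def less_Suc_eq)
next
  case (s4_fin d)
  then show ?thesis
    using assms(2) frob_dim_1_imp_maximal maximal_imp_frob_dim_1 by (auto simp: first_loop_def)
next
  case (s4_inf d)
  then show ?thesis using assms(2) by (simp add: first_loop_def second_loop_def)
next
  case (s51 l d)
  then show ?thesis using assms(2) linear_forms_subset by auto
next
  case (s52_red \<mu> d)
  then show ?thesis using assms(2) maximal_imp_not_reducible by (auto simp: second_loop_def)
next
  case (s53_eq \<mu> d)
  then show ?thesis using assms(2) full_degree_imp_maximal by (auto simp: second_loop_def)
qed (use assms(2) in auto)

lemma run_invariant_reachable:
  "(proc_step n I)\<^sup>*\<^sup>* s s' \<Longrightarrow> run_invariant n I s \<Longrightarrow> run_invariant n I s'"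
  by (induction rule: rtranclp_induct) (auto intro: run_invariant_step)

end

text \<open>
  Each round of the first loop takes three transitions. The states of the second loop get the
  default value \<open>0\<close>: the invariant excludes them when the field is finite.
\<close>

fun steps_left :: "nat \<Rightarrow> 'p state \<Rightarrow> nat" where
  "steps_left n Step1 = 3 * n + 4"
| "steps_left n Step2 = 3 * n + 3"
| "steps_left n (Step3_1 d i) = 3 * (n + 1 - i) + 2"
| "steps_left n (Step3_2 d i \<mu>) = 3 * (n + 1 - i) + 1"
| "steps_left n (Step3_3 d i \<mu>) = 3 * (n + 1 - i)"
| "steps_left n (Step4 d) = 1"
| "steps_left n _ = 0"

lemma steps_left_decreases:
  fixes I :: "'k::field mpoly set"
  assumes "proc_step n I s s'" "run_invariant n I s" "finite (UNIV :: 'k set)"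
  shows "steps_left n s' < steps_left n s"
  using assms by cases (auto simp: Suc_diff_le second_loop_def)

text \<open>
  In the second loop the zero form is always available as a choice.
\<close>

lemma not_stuck: "(\<exists>b. s = Return b) \<or> (\<exists>s'. proc_step n (I :: 'k::field mpoly set) s s')"
proof (cases s)
  case Step1
  then show ?thesis by (cases "zero_dimensional n I") (auto intro: proc_step.intros)
next
  case (Step3_1 d i)
  then show ?thesis by (cases "i > n") (auto intro: proc_step.intros simp: not_less)
next
  case (Step3_2 d i \<mu>)
  then show ?thesis by (cases "reducible \<mu>") (auto intro: proc_step.intros)
next
  case (Step3_3 d i \<mu>)
  then show ?thesis by (cases "Polynomial.degree \<mu> = d") (auto intro: proc_step.intros)
next
  case (Step4 d)
  then show ?thesis by (cases "finite (UNIV :: 'k set)") (auto intro: proc_step.intros)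
next
  case (Step5_1 d)
  have "(\<Sum>i\<in>{1..n}. Const 0 * Var i) \<in> (linear_forms n :: 'k mpoly set)"
    unfolding linear_forms_def by (intro CollectI exI[of _ "\<lambda>_. 0"]) simp
  then show ?thesis using Step5_1 by (auto intro: proc_step.intros)
next
  case (Step5_2 d \<mu>)
  then show ?thesis by (cases "reducible \<mu>") (auto intro: proc_step.intros)
next
  case (Step5_3 d \<mu>)
  then show ?thesis by (cases "Polynomial.degree \<mu> = d") (auto intro: proc_step.intros)
qed (auto intro: proc_step.intros)

theorem mainTheorem7:
  fixes n :: nat and I :: "'k::field mpoly set"
  assumes "perfect_field TYPE('k)"
    and "ideal I (mpoly_ring n)"
  shows "(\<forall>b. returns n I b \<longrightarrow> (b \<longleftrightarrow> maximalideal I (mpoly_ring n))) \<and>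
    (finite (UNIV :: 'k set) \<longrightarrow> always_terminates n I)"
proof (intro conjI allI impI)
  interpret mpoly_ideal n I by (rule mpoly_ideal.intro) (fact assms(2))
  fix b assume "returns n I b"
  then have "run_invariant n I (Return b)"
    unfolding returns_def by (rule run_invariant_reachable) simp
  then show "b \<longleftrightarrow> maximalideal I (mpoly_ring n)" by simp
next
  interpret mpoly_ideal n I by (rule mpoly_ideal.intro) (fact assms(2))
  assume fin: "finite (UNIV :: 'k set)"
  have False if run: "\<sigma> 0 = Step1" "\<And>t. proc_step n I (\<sigma> t) (\<sigma> (Suc t))" for \<sigma>
  proof -
    have inv: "run_invariant n I (\<sigma> t)" for t
      by (induction t) (use run run_invariant_step in auto)
    have "steps_left n (\<sigma> t) + t \<le> steps_left n (\<sigma> 0)" for t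
    proof (induction t)
      case (Suc t)
      then show ?case using steps_left_decreases[OF run(2) inv fin, of t] by simp
    qed simp
    from this[of "Suc (steps_left n (\<sigma> 0))"] show False by simp
  qed
  then show "always_terminates n I"
    unfolding always_terminates_def using not_stuck by blast
qed

end
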